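(* Let $\Bbbk$ be an arbitrary field. There exists a simple finitely generated unital $\Bbbk$-algebra that has Gelfand–Kirillov dimension $2$ but does not have quadratic growth.
   Context: For a finitely generated unital $\Bbbk$-algebra $\mathcal{A}$, let $V$ be the $\Bbbk$-linear span of a finite generating set containing the unit and let $V^n$ be the linear span of all products $a_1\cdots a_n$ with $a_i\in V$. The growth of $\mathcal{A}$ is $\gamma(n)=\dim V^n$. The Gelfand–Kirillov dimension of $\mathcal{A}$ is $\limsup_{n\to\infty}\frac{\log\dim V^n}{\log n}$ (independent of the choice of $V$). $\mathcal{A}$ has quadratic growth if there is a constant $C>1$ such that $C^{-1}n^2\le\gamma(n)\le Cn^2$ for all $n\ge 1$ (the property does not depend on the choice of $V$). *)

theory Defs
  imports
    "HOL-Library.Extended_Real"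
    "HOL-Algebra.Ideal"
    "HOL-Algebra.Subrings"
    "Jordan_Normal_Form.Missing_VectorSpace"
begin

(* The library locale "algebra" requires the algebra to be commutative. Without commutativity,
   compatibility of scalars with multiplication has to be required in both arguments. *)
locale unital_algebra = vectorspace K A + A: ring A for K and A (structure) +
  assumes smult_mult_left:
      "\<lbrakk>c \<in> carrier K; x \<in> carrier A; y \<in> carrier A\<rbrakk> \<Longrightarrow> (c \<odot> x) \<otimes> y = c \<odot> (x \<otimes> y)"
    and smult_mult_right:
      "\<lbrakk>c \<in> carrier K; x \<in> carrier A; y \<in> carrier A\<rbrakk> \<Longrightarrow> x \<otimes> (c \<odot> y) = c \<odot> (x \<otimes> y)"

(* "ideal" is two-sided; in a unital algebra every ring ideal is a linear subspace. *)
definition simple_algebra :: "('a, 'm) ring_scheme \<Rightarrow> bool" where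
  "simple_algebra A \<longleftrightarrow>
     carrier A \<noteq> {\<zero>\<^bsub>A\<^esub>} \<and> (\<forall>I. ideal I A \<longrightarrow> I = {\<zero>\<^bsub>A\<^esub>} \<or> I = carrier A)"

(* "subring" includes the unit. *)
definition generates_algebra ::
    "('k, 'l) ring_scheme \<Rightarrow> ('k, 'a, 'm) module_scheme \<Rightarrow> 'a set \<Rightarrow> bool" where
  "generates_algebra K A S \<longleftrightarrow> S \<subseteq> carrier A \<and>
     (\<forall>B. subring B A \<and> VectorSpace.subspace K B A \<and> S \<subseteq> B \<longrightarrow> B = carrier A)"

definition finitely_generated_algebra ::
    "('k, 'l) ring_scheme \<Rightarrow> ('k, 'a, 'm) module_scheme \<Rightarrow> bool" where
  "finitely_generated_algebra K A \<longleftrightarrow> (\<exists>S. finite S \<and> generates_algebra K A S)"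

definition unital_generating_set ::
    "('k, 'l) ring_scheme \<Rightarrow> ('k, 'a, 'm) module_scheme \<Rightarrow> 'a set \<Rightarrow> bool" where
  "unital_generating_set K A S \<longleftrightarrow> finite S \<and> \<one>\<^bsub>A\<^esub> \<in> S \<and> generates_algebra K A S"

definition power_space ::
    "('k, 'l) ring_scheme \<Rightarrow> ('k, 'a, 'm) module_scheme \<Rightarrow> 'a set \<Rightarrow> nat \<Rightarrow> 'a set" where
  "power_space K A V n =
     module.span K A {foldr (mult A) as \<one>\<^bsub>A\<^esub> | as. length as = n \<and> set as \<subseteq> V}"

definition growth ::
    "('k, 'l) ring_scheme \<Rightarrow> ('k, 'a, 'm) module_scheme \<Rightarrow> 'a set \<Rightarrow> nat \<Rightarrow> nat" where
  "growth K A S n =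
     vectorspace.dim K (A\<lparr>carrier := power_space K A (module.span K A S) n\<rparr>)"

(* The upper limit and the quadratic bounds do not depend on the generating set S. The quantifiers
   over S in the next two definitions are chosen so that a theorem asserting a value of the
   dimension, or denying quadratic growth, speaks about every S. *)
definition has_GK_dimension ::
    "('k, 'l) ring_scheme \<Rightarrow> ('k, 'a, 'm) module_scheme \<Rightarrow> ereal \<Rightarrow> bool" where
  "has_GK_dimension K A d \<longleftrightarrow> finitely_generated_algebra K A \<and>
     (\<forall>S. unital_generating_set K A S \<longrightarrow>
       limsup (\<lambda>n. ereal (ln (real (growth K A S n)) / ln (real n))) = d)"

definition quadratic_growth ::
    "('k, 'l) ring_scheme \<Rightarrow> ('k, 'a, 'm) module_scheme \<Rightarrow> bool" where
  "quadratic_growth K A \<longleftrightarrow>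
     (\<exists>S. unital_generating_set K A S \<and>
       (\<exists>C::real. C > 1 \<and> (\<forall>n\<ge>1.
          inverse C * (real n)\<^sup>2 \<le> real (growth K A S n) \<and>
          real (growth K A S n) \<le> C * (real n)\<^sup>2)))"

(* HOL cannot quantify existentially over types, so the carrier type of an algebra whose existence
   is claimed must be named. This type loses nothing: a finitely generated algebra has countable
   dimension, so by its regular representation it is isomorphic to an algebra whose elements are
   matrices over K with rows and columns indexed by a countably infinite set. Only the elements have
   this type: the operations are fields of the record, and need not be the matrix operations. *)
type_synonym 'k fg_algebra_record = "('k, int \<Rightarrow> int \<Rightarrow> 'k) module"

end

theory Submission
  imports Defs "HOL-Real_Asymp.Real_Asymp"
begin

text \<open>
  The algebra consists of matrices over \<open>K\<close> whose rows and columns are indexed by the integers. A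
  sequence \<open>w\<close> of bits is fixed, and a matrix \<open>a\<close> is admitted if for some \<open>N\<close> it vanishes
  further than \<open>N\<close> from the diagonal and \<open>a i (i + d)\<close> depends only on \<open>d\<close> and on the window of
  radius \<open>N\<close> of \<open>w\<close> around \<open>i\<close>. These matrices form a unital algebra; it is the convolution
  algebra of the shift acting on the orbit closure of \<open>w\<close>, made concrete. Both
  properties required of it are properties of \<open>w\<close>.

  Growth. The matrices of range \<open>N\<close> have a basis of 0-1 matrices, one for each word of length
  \<open>2 N + 1\<close> in \<open>w\<close> and each \<open>d\<close> with \<open>\<bar>d\<bar> \<le> N\<close>. Hence their space has dimension \<open>(2 N + 1) p (2 N + 1)\<close>,
  where \<open>p m\<close> is the number of words of length \<open>m\<close> in \<open>w\<close>. Each basis element is a product of at most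
  \<open>10 N\<close> of the five generators (the unit, the two translations, the indicators of the two letters),
  so the growth with respect to any generating set agrees with \<open>n \<mapsto> (2 n + 1) p (2 n + 1)\<close> up to
  a linear change of the argument (\<open>growth_upper\<close>, \<open>growth_lower\<close>). It remains to find \<open>w\<close> such that
  \<open>p n / n\<close> is unbounded, although \<open>p n\<close> is at most \<open>n\<close> to the power \<open>1 + o(1)\<close>.

  Simplicity. A nonzero ideal contains some \<open>a\<close> with a nonzero diagonal entry \<open>c = a i i\<close>. Let \<open>P\<close>
  be the diagonal projection onto the positions at which a long window of \<open>w\<close> looks as it does at
  \<open>i\<close>. If equal long windows cannot occur close to each other, then \<open>P a P = c P\<close>, so \<open>P\<close> is in
  the ideal (\<open>ideal_contains_window\<close>). If moreover every window recurs along an arithmetic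
  progression, then finitely many translates of \<open>P\<close> cover the diagonal, and the ideal contains the unit
  (\<open>simple_alg\<close>).

  The sequence. A Toeplitz sequence is filled in levels. At level \<open>k\<close> every residue class modulo \<open>r\<close>,
  where \<open>r = period k\<close>, but one receives a constant bit, and the positions of the remaining class carry the
  sequence of level \<open>k + 1\<close>. The bits of level \<open>k\<close> spell out all words of length \<open>k + 1\<close>, followed by
  a long run of zeros which makes the phase modulo \<open>r\<close> visible in every window of length \<open>r\<close>. A word of
  length \<open>m r\<close> is therefore the same thing as a phase and a word of length \<open>m\<close> of the next level
  (\<open>complexity_step\<close>), so \<open>p (m q) = q p' m\<close>, where \<open>q\<close> is the product of the first \<open>k\<close> periods and
  \<open>p'\<close> belongs to level \<open>k\<close>. Since \<open>p' (k + 1) \<ge> 2 ^ (k + 1)\<close>, the quotient \<open>p n / n\<close> is unbounded.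
  Since \<open>p' 1 \<le> 2\<close>, one has \<open>p n \<le> 2 r n\<close> for \<open>q \<le> n < q r\<close>, and here \<open>log r\<close> is of order \<open>k\<close>
  whereas \<open>log q\<close> is of order at least \<open>k\<^sup>2\<close>.
\<close>

section \<open>Words of a two-sided sequence\<close>

definition word_at :: "(int \<Rightarrow> bool) \<Rightarrow> int \<Rightarrow> nat \<Rightarrow> bool list" where
  "word_at w x m = map (\<lambda>i. w (x + int i)) [0..<m]"

definition complexity :: "(int \<Rightarrow> bool) \<Rightarrow> nat \<Rightarrow> nat" where
  "complexity w m = card (range (\<lambda>x. word_at w x m))"

lemma word_at_eq_iff: "word_at w x m = word_at v y m \<longleftrightarrow> (\<forall>i<m. w (x + int i) = v (y + int i))"
  by (auto simp: word_at_def)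

lemma finite_words: "finite (range (\<lambda>x. word_at w x m))"
proof (rule finite_subset)
  show "range (\<lambda>x. word_at w x m) \<subseteq> {xs. set xs \<subseteq> UNIV \<and> length xs = m}"
    by (auto simp: word_at_def)
qed (rule finite_lists_length_eq, simp)

lemma card_range_eqI:
  assumes "\<And>x y. f x = f y \<longleftrightarrow> g x = g y"
  shows "card (range f) = card (range g)"
proof (rule bij_betw_same_card)
  show "bij_betw (\<lambda>u. g (inv_into UNIV f u)) (range f) (range g)"
    unfolding bij_betw_def
  proof
    have *: "f (inv_into UNIV f (f x)) = f x" for x by (simp add: f_inv_into_f)
    show "inj_on (\<lambda>u. g (inv_into UNIV f u)) (range f)"
      by (rule inj_onI) (metis assms * rangeE)
    have "g (inv_into UNIV f (f x)) = g x" for x using * assms by blast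
    then show "(\<lambda>u. g (inv_into UNIV f u)) ` range f = range g" by (auto simp: image_image)
  qed
qed

lemma complexity_mono:
  assumes "m \<le> n" shows "complexity w m \<le> complexity w n"
proof -
  have "word_at w x m = take m (word_at w x n)" for x
    using assms by (simp add: word_at_def take_map)
  then have "range (\<lambda>x. word_at w x m) = take m ` range (\<lambda>x. word_at w x n)" by auto
  then show ?thesis unfolding complexity_def by (metis card_image_le finite_words)
qed

lemma complexity_1: "complexity w 1 \<le> 2"
proof -
  have "range (\<lambda>x. word_at w x 1) \<subseteq> {[True], [False]}" by (auto simp: word_at_def)
  then have "complexity w 1 \<le> card {[True], [False]}"
    unfolding complexity_def by (intro card_mono) auto
  then show ?thesis by simp
qed

lemma complexity_pos: "complexity w m > 0"
  unfolding complexity_def by (simp add: card_gt_0_iff finite_words)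

section \<open>A Toeplitz sequence\<close>

text \<open>The pattern of level \<open>k\<close> lists the binary expansions, least significant bit first and padded to
  \<open>k + 1\<close> digits, of the numbers below \<open>2 ^ (k + 1)\<close>, and is then padded with zeros. The zeros take up
  exactly half of the period, which is what \<open>toeplitz_phase\<close> needs.\<close>

definition pattern_length :: "nat \<Rightarrow> nat" where
  "pattern_length k = Suc k * 2 ^ Suc k"

definition period :: "nat \<Rightarrow> nat" where
  "period k = 2 * pattern_length k + 2"

definition pattern :: "nat \<Rightarrow> nat \<Rightarrow> bool" where
  "pattern k x \<longleftrightarrow> x < pattern_length k \<and> bit (x div Suc k) (x mod Suc k)"

lemma pattern_length_ge: "pattern_length k \<ge> 2"
proof -
  have "(1::nat) * 2 ^ 1 \<le> Suc k * 2 ^ Suc k" by (intro mult_le_mono power_increasing) auto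
  then show ?thesis by (simp add: pattern_length_def)
qed

lemma period_ge: "period k \<ge> 6"
  using pattern_length_ge[of k] by (simp add: period_def)

text \<open>The hole is the last residue class modulo the period, so that a window of length \<open>m * period k\<close>
  contains the holes number \<open>x div period k + 1\<close> to \<open>x div period k + m\<close>, whatever its start \<open>x\<close>. The
  hole number \<open>s\<close> sits at \<open>period k * s - 1\<close> rather than \<open>period k * s + period k - 1\<close>: with the latter numbering
  the position \<open>-1\<close> would refer to itself at every level and never be filled.\<close>

function toeplitz :: "nat \<Rightarrow> int \<Rightarrow> bool" where
  "toeplitz k j = (if int (period k) dvd j + 1 then toeplitz (Suc k) ((j + 1) div int (period k))
     else pattern k (nat (j mod int (period k))))"
  by pat_completeness auto
termination
proof (relation "measure (\<lambda>(k, j). nat \<bar>j\<bar>)", goal_cases)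
  case (2 k j)
  then obtain s where s: "j + 1 = int (period k) * s" by (auto elim: dvdE)
  have r: "int (period k) \<ge> 6" using period_ge[of k] by simp
  have "\<bar>s\<bar> < \<bar>j\<bar>"
  proof (cases "s \<ge> 1")
    case True
    then have "int (period k) * s \<ge> 6 * s" using r by (intro mult_right_mono) auto
    then show ?thesis using s True by linarith
  next
    case False
    then have "int (period k) * (- s) \<ge> 6 * (- s)" using r by (intro mult_right_mono) auto
    then show ?thesis using s False by linarith
  qed
  then show ?case using s r by simp
qed simp

declare toeplitz.simps [simp del]

lemma toeplitz_hole: "toeplitz k (int (period k) * s - 1) = toeplitz (Suc k) s"
  using period_ge[of k] by (subst toeplitz.simps) simp

lemma toeplitz_pattern:
  assumes "j mod int (period k) = int x" "x < period k - 1"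
  shows "toeplitz k j = pattern k x"
proof -
  have "\<not> int (period k) dvd j + 1"
  proof
    assume "int (period k) dvd j + 1"
    then have "int (period k) dvd j mod int (period k) + 1"
      by (metis dvd_eq_mod_eq_0 mod_add_left_eq)
    then have "int (period k) \<le> int x + 1" using assms(1) by (simp add: zdvd_imp_le)
    then show False using assms(2) by linarith
  qed
  then show ?thesis by (subst toeplitz.simps) (simp add: assms(1))
qed

text \<open>Every position is filled at some finite level, and then its bit is repeated along the residue class
  modulo the product of the periods up to that level. This is the recurrence used for simplicity.\<close>

lemma toeplitz_returns: "\<exists>q>0. \<forall>t. toeplitz k (j + q * t) = toeplitz k j"
proof (induction k j rule: toeplitz.induct)
  case (1 k j)
  define r where "r = int (period k)"
  have r: "r > 0" using period_ge[of k] by (simp add: r_def)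
  show ?case
  proof (cases "r dvd j + 1")
    case True
    then obtain s where s: "j + 1 = r * s" by (auto elim: dvdE)
    then have "(j + 1) div r = s" using r by simp
    with 1 True obtain q where q: "q > 0" "\<And>t. toeplitz (Suc k) (s + q * t) = toeplitz (Suc k) s"
      unfolding r_def by auto
    have "toeplitz k (j + r * q * t) = toeplitz k j" for t
    proof -
      have "j + r * q * t = r * (s + q * t) - 1" "j = r * s - 1" using s by (auto simp: algebra_simps)
      then show ?thesis unfolding r_def using q(2) toeplitz_hole by metis
    qed
    then show ?thesis using q(1) r by (intro exI[of _ "r * q"]) auto
  next
    case False
    then have "toeplitz k (j + r * t) = toeplitz k j" for t
    proof -
      have "r dvd j + r * t + 1 \<longleftrightarrow> r dvd j + 1"
        by (metis add.assoc add.commute dvd_add_times_triv_left_iff mult.commute)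
      then show ?thesis using False unfolding r_def
        by (subst (1 2) toeplitz.simps) simp
    qed
    then show ?thesis using r by blast
  qed
qed

text \<open>Suppose that the two phases differ by \<open>d\<close>, and exchange the words if necessary, so that \<open>d\<close> is at
  most half of the period. The last 1 of the pattern (the last digit of the all-ones word) is then shifted by
  \<open>d\<close> into the run of zeros without reaching the hole, so the two words differ there. The bits in the holes
  are never consulted.\<close>

lemma toeplitz_phase:
  assumes "m \<ge> 1" and eq: "word_at (toeplitz k) x (m * period k) = word_at (toeplitz k) y (m * period k)"
  shows "x mod int (period k) = y mod int (period k)"
proof -
  define r where "r = int (period k)"
  define l where "l = pattern_length k"
  have r: "r = 2 * int l + 2" "l \<ge> 2"
    using pattern_length_ge[of k] by (auto simp: r_def period_def l_def)
  have last: "pattern k (l - 1)"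
  proof -
    have e: "l - 1 = Suc k * (2 ^ Suc k - 1) + k"
    proof -
      have *: "Suc k * 2 ^ Suc k = Suc k * (2 ^ Suc k - 1) + Suc k * 1"
        unfolding distrib_left[symmetric] by simp
      have "b - 1 = c + k" if "b = c + Suc k * 1" for b c :: nat using that by simp
      from this[OF *] show ?thesis unfolding l_def pattern_length_def .
    qed
    have "(l - 1) div Suc k = 2 ^ Suc k - 1" "(l - 1) mod Suc k = k"
      unfolding e by (simp_all del: power_Suc mult_Suc)
    then show ?thesis using r(2) bit_mask_iff[of "Suc k" k, where 'a=nat]
      unfolding pattern_def l_def mask_eq_exp_minus_1 by (simp del: power_Suc)
  qed
  have False if "0 < (y - x) mod r" "(y - x) mod r \<le> int l + 1"
    "\<forall>i < m * period k. toeplitz k (x + int i) = toeplitz k (y + int i)" for x y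
  proof -
    define d where "d = nat ((y - x) mod r)"
    \<comment> \<open>The offset at which the word starting at \<open>x\<close> shows the last 1 of the pattern.\<close>
    define i where "i = nat ((int (l - 1) - x) mod r)"
    have i: "int i = (int (l - 1) - x) mod r" using r by (simp add: i_def)
    have d: "int d = (y - x) mod r" using r by (simp add: d_def)
    have "int i < r" using i r by simp
    then have "i < period k" by (simp add: r_def)
    also have "period k \<le> m * period k" using assms(1) by simp
    finally have im: "i < m * period k" .
    have "(x + int i) mod r = int (l - 1) mod r" unfolding i by (simp add: mod_simps)
    then have "(x + int i) mod r = int (l - 1)" using r by simp
    then have 1: "toeplitz k (x + int i) = pattern k (l - 1)"
      using r by (intro toeplitz_pattern) (auto simp: r_def)
    have "(y + int i) mod r = (int (l - 1) + int d) mod r"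
      unfolding i d by (simp add: mod_simps algebra_simps)
    also have "\<dots> = int (l - 1 + d)"
      using r that d by (subst mod_pos_pos_trivial) auto
    finally have "toeplitz k (y + int i) = pattern k (l - 1 + d)"
      using that r d by (intro toeplitz_pattern) (auto simp: r_def)
    moreover have "\<not> pattern k (l - 1 + d)"
      using that d by (auto simp: pattern_def l_def)
    ultimately show False using 1 last that(3) im by blast
  qed
  note key = this
  have e1: "\<forall>i < m * period k. toeplitz k (x + int i) = toeplitz k (y + int i)"
    using eq by (simp add: word_at_eq_iff)
  have "(y - x) mod r = 0"
  proof (rule ccontr)
    assume n: "(y - x) mod r \<noteq> 0"
    have b: "0 \<le> (y - x) mod r" "(y - x) mod r < r" using r by auto
    show False
    proof (cases "(y - x) mod r \<le> int l + 1")
      case True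
      then show False using key[of y x] n b e1 by simp
    next
      case False
      have "(x - y) mod r = r - (y - x) mod r"
        using n zmod_zminus1_eq_if[of "y - x" r] by simp
      then show False using key[of x y] False b e1 r by simp
    qed
  qed
  then have "r dvd y - x" by (simp add: dvd_eq_mod_eq_0)
  then show ?thesis unfolding r_def by (metis mod_eq_dvd_iff)
qed

lemma toeplitz_word_eq_iff:
  fixes k :: nat
  assumes "m \<ge> 1"
  defines "r \<equiv> int (period k)"
  shows "word_at (toeplitz k) x (m * period k) = word_at (toeplitz k) y (m * period k) \<longleftrightarrow>
    x mod r = y mod r \<and>
    word_at (toeplitz (Suc k)) (x div r + 1) m = word_at (toeplitz (Suc k)) (y div r + 1) m"
    (is "?l \<longleftrightarrow> ?r")
proof
  have r: "r > 0" using period_ge[of k] by (simp add: r_def)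
  { assume l: ?l
    then have mod: "x mod r = y mod r" using toeplitz_phase assms by blast
    have "toeplitz (Suc k) (x div r + 1 + int i) = toeplitz (Suc k) (y div r + 1 + int i)" if "i < m" for i
    proof -
      define o' where "o' = nat (r * (int i + 1) - 1 - x mod r)"
      have o1: "0 \<le> r * (int i + 1) - 1 - x mod r"
      proof -
        have "r * 1 \<le> r * (int i + 1)" using r by (intro mult_left_mono) auto
        moreover have "x mod r < r" using r by simp
        ultimately show ?thesis by linarith
      qed
      have o2: "int o' = r * (int i + 1) - 1 - x mod r" using o1 by (simp add: o'_def)
      have "r * (int i + 1) \<le> r * int m" using r that by (intro mult_left_mono) auto
      moreover have "x mod r \<ge> 0" using r by simp
      ultimately have "int o' < int (m * period k)" using o2 by (simp add: r_def mult.commute)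
      then have "o' < m * period k" by linarith
      then have e: "toeplitz k (x + int o') = toeplitz k (y + int o')"
        using l by (simp add: word_at_eq_iff)
      have "z + int o' = r * (z div r + 1 + int i) - 1" if "z mod r = x mod r" for z
      proof -
        have "z = r * (z div r) + x mod r" using that by (metis mult_div_mod_eq)
        then show ?thesis unfolding o2 by (simp add: algebra_simps)
      qed
      from this[of x] this[of y] show ?thesis using e mod toeplitz_hole unfolding r_def by metis
    qed
    then show ?r using mod by (simp add: word_at_eq_iff)
  }
  { assume rr: ?r
    have "toeplitz k (x + int i) = toeplitz k (y + int i)" if i: "i < m * period k" for i
    proof (cases "r dvd x + int i + 1")
      case True
      have md: "(x + int i + 1) mod r = (x mod r + int i + 1) mod r"
        by (metis mod_add_left_eq add.assoc)
      then have "r dvd x mod r + int i + 1" using True by (metis dvd_eq_mod_eq_0)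
      then obtain s where s: "x mod r + int i + 1 = r * s" by (auto elim: dvdE)
      have "x mod r \<ge> 0" using r by simp
      then have "r * s > 0" using s by linarith
      then have s1: "s \<ge> 1" using r by (simp add: zero_less_mult_iff)
      have "x mod r < r" using r by simp
      moreover have "int i + 1 \<le> int m * r" using i unfolding r_def
        by (metis Suc_leI of_nat_Suc of_nat_le_iff of_nat_mult add.commute)
      ultimately have "r * s < r * (int m + 1)" using s by (simp add: algebra_simps)
      then have s2: "s < int m + 1" using r by simp
      have e: "z + int i = r * (z div r + 1 + int (nat (s - 1))) - 1" if "z mod r = x mod r" for z
      proof -
        have "z = r * (z div r) + x mod r" using that by (metis mult_div_mod_eq)
        then have "z + int i = r * (z div r) + r * s - 1" using s by simp
        then show ?thesis using s1 by (simp add: algebra_simps)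
      qed
      have "nat (s - 1) < m" using s1 s2 by linarith
      then show ?thesis using e[of x] e[of y] rr toeplitz_hole
        unfolding r_def word_at_eq_iff by metis
    next
      case False
      have "(x + int i) mod r = (y + int i) mod r" "(x + int i + 1) mod r = (y + int i + 1) mod r"
        using rr by (metis mod_add_left_eq, metis mod_add_left_eq add.assoc)
      moreover from this have "\<not> r dvd y + int i + 1" using False by (metis dvd_eq_mod_eq_0)
      ultimately show ?thesis using False unfolding r_def
        by (subst (1 2) toeplitz.simps) simp
    qed
    then show ?l by (simp add: word_at_eq_iff)
  }
qed

text \<open>The two components of \<open>toeplitz_word_eq_iff\<close> vary independently: any phase can be combined
  with any word of the next level.\<close>

lemma complexity_step:
  assumes "m \<ge> 1"
  shows "complexity (toeplitz k) (m * period k) = period k * complexity (toeplitz (Suc k)) m"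
proof -
  define r where "r = int (period k)"
  have r: "r > 0" using period_ge[of k] by (simp add: r_def)
  define g where "g = (\<lambda>x. (x mod r, word_at (toeplitz (Suc k)) (x div r + 1) m))"
  have "complexity (toeplitz k) (m * period k) = card (range g)"
    unfolding complexity_def
    by (rule card_range_eqI) (use assms toeplitz_word_eq_iff in \<open>auto simp: g_def r_def\<close>)
  also have "range g = {0..<r} \<times> range (\<lambda>x. word_at (toeplitz (Suc k)) x m)"
  proof (intro equalityI subsetI, goal_cases)
    case (1 u)
    then obtain x where "u = g x" by (elim rangeE)
    then show ?case using r by (simp add: g_def)
  next
    case (2 u)
    then obtain a z where u: "u = (a, word_at (toeplitz (Suc k)) z m)" and a: "0 \<le> a" "a < r"
      by (elim SigmaE rangeE) simp
    have "(r * (z - 1) + a) mod r = a" "(r * (z - 1) + a) div r = z - 1"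
      using a r by simp_all
    then have "g (r * (z - 1) + a) = u" by (simp add: g_def u)
    then show ?case by (metis rangeI)
  qed
  also have "card \<dots> = period k * complexity (toeplitz (Suc k)) m"
    by (simp add: card_cartesian_product r_def complexity_def)
  finally show ?thesis .
qed

definition level_length :: "nat \<Rightarrow> nat" where
  "level_length k = (\<Prod>i<k. period i)"

lemma level_length_0 [simp]: "level_length 0 = 1"
  and level_length_Suc [simp]: "level_length (Suc k) = level_length k * period k"
  by (auto simp: level_length_def)

lemma complexity_level:
  "m \<ge> 1 \<Longrightarrow> complexity (toeplitz 0) (m * level_length k) = level_length k * complexity (toeplitz k) m"
proof (induction k arbitrary: m)
  case (Suc k)
  have "m * period k \<ge> 1" using Suc.prems period_ge[of k] by simp
  from Suc.IH[OF this] show ?case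
    using complexity_step[OF Suc.prems] by (simp add: ac_simps)
qed simp

text \<open>Matching words of length \<open>m * period k\<close> have equal phases and descend to matching words of the next
  level, so each level contributes a factor \<open>period k\<close> to the distance between two occurrences.\<close>

lemma toeplitz_return_dvd:
  assumes "m \<ge> 1"
    "word_at (toeplitz 0) x (m * level_length k) = word_at (toeplitz 0) y (m * level_length k)"
  shows "\<exists>x' y'. x - y = int (level_length k) * (x' - y') \<and>
    word_at (toeplitz k) x' m = word_at (toeplitz k) y' m"
  using assms
proof (induction k arbitrary: m)
  case 0
  then show ?case by auto
next
  case (Suc k)
  have "m * period k \<ge> 1" using Suc.prems period_ge[of k] by simp
  moreover have "m * period k * level_length k = m * level_length (Suc k)"
    by (simp add: ac_simps)
  ultimately obtain x' y' where
    1: "x - y = int (level_length k) * (x' - y')"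
      "word_at (toeplitz k) x' (m * period k) = word_at (toeplitz k) y' (m * period k)"
    using Suc.IH[of "m * period k"] Suc.prems(2) by metis
  define r where "r = int (period k)"
  from 1(2) toeplitz_word_eq_iff[OF Suc.prems(1)]
  have 2: "x' mod r = y' mod r"
      "word_at (toeplitz (Suc k)) (x' div r + 1) m = word_at (toeplitz (Suc k)) (y' div r + 1) m"
    by (auto simp: r_def)
  have "x' - y' = r * (x' div r - y' div r)"
    using mult_div_mod_eq[of r x'] mult_div_mod_eq[of r y'] 2(1)
    unfolding right_diff_distrib by linarith
  then have "x - y = int (level_length (Suc k)) * ((x' div r + 1) - (y' div r + 1))"
    using 1(1) by (simp add: r_def)
  then show ?case using 2(2) by blast
qed

text \<open>The word spelling the digits of \<open>a\<close> starts at position \<open>(k + 1) * a\<close>.\<close>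

lemma complexity_toeplitz_ge: "complexity (toeplitz k) (Suc k) \<ge> 2 ^ Suc k"
proof -
  let ?f = "\<lambda>a::nat. word_at (toeplitz k) (int (Suc k * a)) (Suc k)"
  have v: "toeplitz k (int (Suc k * a) + int i) = bit a i" if "a < 2 ^ Suc k" "i < Suc k" for a i
  proof -
    have "Suc k * a + i < Suc k * (a + 1)" using that by simp
    also have "\<dots> \<le> pattern_length k" unfolding pattern_length_def
      using that by (intro mult_left_mono) auto
    finally have l: "Suc k * a + i < pattern_length k" .
    then have p: "Suc k * a + i < period k" "Suc k * a + i < period k - 1"
      unfolding period_def by linarith+
    then have "int (Suc k * a + i) < int (period k)" by (simp only: of_nat_less_iff)
    then have "toeplitz k (int (Suc k * a + i)) = pattern k (Suc k * a + i)"
      using p(2) by (intro toeplitz_pattern mod_pos_pos_trivial of_nat_0_le_iff)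
    then have "toeplitz k (int (Suc k * a) + int i) = pattern k (Suc k * a + i)"
      by (simp only: of_nat_add)
    moreover have "(Suc k * a + i) div Suc k = a" "(Suc k * a + i) mod Suc k = i"
      using that(2) by (simp_all del: mult_Suc)
    ultimately show ?thesis using l unfolding pattern_def by simp
  qed
  have "inj_on ?f {..<2 ^ Suc k}"
  proof (rule inj_onI)
    fix a b :: nat assume ab: "a \<in> {..<2 ^ Suc k}" "b \<in> {..<2 ^ Suc k}" and eq: "?f a = ?f b"
    have bits: "bit a i \<longleftrightarrow> bit b i" if i: "i < Suc k" for i
    proof -
      have "toeplitz k (int (Suc k * a) + int i) = toeplitz k (int (Suc k * b) + int i)"
        using eq i unfolding word_at_eq_iff by blast
      then show ?thesis using v[of a i, OF _ i] v[of b i, OF _ i] ab unfolding lessThan_iff by simp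
    qed
    have "take_bit (Suc k) a = a" "take_bit (Suc k) b = b"
      using ab unfolding take_bit_nat_eq_self_iff lessThan_iff by blast+
    moreover have "take_bit (Suc k) a = take_bit (Suc k) b"
      by (rule bit_eqI) (simp only: bit_take_bit_iff bits cong: conj_cong)
    ultimately show "a = b" by metis
  qed
  then have "2 ^ Suc k = card (?f ` {..<2 ^ Suc k})" by (simp add: card_image)
  also have "\<dots> \<le> complexity (toeplitz k) (Suc k)"
    unfolding complexity_def by (intro card_mono finite_words) auto
  finally show ?thesis .
qed

section \<open>Finite sums in an abelian monoid\<close>

lemma (in abelian_monoid) finsum_eq_single:
  assumes "finite S" "x \<in> S" "f \<in> S \<rightarrow> carrier G" "\<And>y. y \<in> S \<Longrightarrow> y \<noteq> x \<Longrightarrow> f y = \<zero>"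
  shows "finsum G f S = f x"
proof -
  have "finsum G f {x} = finsum G f S"
    using assms by (intro add.finprod_mono_neutral_cong_left) auto
  then show ?thesis using assms by (simp add: Pi_def)
qed

lemma (in abelian_monoid) finsum_swap:
  assumes "finite S" "finite T" "\<And>x y. x \<in> S \<Longrightarrow> y \<in> T \<Longrightarrow> f x y \<in> carrier G"
  shows "(\<Oplus>x\<in>S. \<Oplus>y\<in>T. f x y) = (\<Oplus>y\<in>T. \<Oplus>x\<in>S. f x y)"
  using assms(1,3)
proof (induction S rule: finite_induct)
  case empty
  then show ?case by simp
next
  case (insert a S)
  have c: "(\<lambda>y. f a y) \<in> T \<rightarrow> carrier G" "(\<lambda>y. \<Oplus>x\<in>S. f x y) \<in> T \<rightarrow> carrier G"
    using insert.prems by (auto intro!: finsum_closed)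
  have "(\<Oplus>y\<in>T. \<Oplus>x\<in>insert a S. f x y) = (\<Oplus>y\<in>T. f a y \<oplus> (\<Oplus>x\<in>S. f x y))"
  proof (rule finsum_cong')
    fix y assume "y \<in> T"
    then show "(\<Oplus>x\<in>insert a S. f x y) = f a y \<oplus> (\<Oplus>x\<in>S. f x y)"
      using insert by (intro finsum_insert) auto
  qed (use c in auto)
  also have "\<dots> = (\<Oplus>y\<in>T. f a y) \<oplus> (\<Oplus>y\<in>T. \<Oplus>x\<in>S. f x y)"
    using c by (rule finsum_addf)
  also have "\<dots> = (\<Oplus>x\<in>insert a S. \<Oplus>y\<in>T. f x y)"
    using insert c(1) by (subst finsum_insert) (auto intro!: finsum_closed)
  finally show ?case by simp
qed

section \<open>The algebra of finite-range matrices over a sequence\<close>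

locale word_matrices = field K for K :: "('k, 'l) ring_scheme" (structure) +
  fixes w :: "int \<Rightarrow> bool"
begin

definition agree :: "nat \<Rightarrow> int \<Rightarrow> int \<Rightarrow> bool" where
  "agree N i j \<longleftrightarrow> (\<forall>t. \<bar>t\<bar> \<le> int N \<longrightarrow> w (i + t) = w (j + t))"

text \<open>Matrices of range \<open>N\<close>: the band condition makes products finite sums, and the last condition says that
  the entries are functions of the window of radius \<open>N\<close>.\<close>

definition local_matrix :: "nat \<Rightarrow> (int \<Rightarrow> int \<Rightarrow> 'k) \<Rightarrow> bool" where
  "local_matrix N a \<longleftrightarrow> (\<forall>i j. a i j \<in> carrier K) \<and> (\<forall>i j. int N < \<bar>i - j\<bar> \<longrightarrow> a i j = \<zero>) \<and>
     (\<forall>i i' d. agree N i i' \<longrightarrow> a i (i + d) = a i' (i' + d))"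

text \<open>The sum in the product is over a finite set for matrices in the carrier, since their rows have finite
  support.\<close>

definition alg :: "'k fg_algebra_record" where
  "alg = \<lparr>carrier = {a. \<exists>N. local_matrix N a},
     mult = (\<lambda>a b i j. \<Oplus>l\<in>{l. a i l \<noteq> \<zero>}. a i l \<otimes> b l j),
     one = (\<lambda>i j. if i = j then \<one> else \<zero>),
     zero = (\<lambda>i j. \<zero>),
     add = (\<lambda>a b i j. a i j \<oplus> b i j),
     smult = (\<lambda>c a i j. c \<otimes> a i j)\<rparr>"

text \<open>The product of the diagonal matrix with diagonal \<open>f\<close> and the translation by \<open>d\<close>. All
  explicit elements below are of this form, and \<open>shift_mult_shift\<close> computes with them.\<close>

definition shift_matrix :: "(int \<Rightarrow> bool) \<Rightarrow> int \<Rightarrow> int \<Rightarrow> int \<Rightarrow> 'k" where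
  "shift_matrix f d = (\<lambda>i j. if j = i + d \<and> f i then \<one> else \<zero>)"

definition local_set :: "nat \<Rightarrow> (int \<Rightarrow> bool) \<Rightarrow> bool" where
  "local_set N f \<longleftrightarrow> (\<forall>i j. agree N i j \<longrightarrow> f i = f j)"

lemma agree_mono: "agree M i j \<Longrightarrow> N \<le> M \<Longrightarrow> agree N i j"
  by (auto simp: agree_def)

lemma agree_shift:
  assumes "agree M i j" "int N + \<bar>e\<bar> \<le> int M" shows "agree N (i + e) (j + e)"
  unfolding agree_def
proof (intro allI impI)
  fix t assume "\<bar>t\<bar> \<le> int N"
  then have "\<bar>e + t\<bar> \<le> int M" using assms(2) by linarith
  then have "w (i + (e + t)) = w (j + (e + t))" using assms(1) by (simp add: agree_def)
  then show "w (i + e + t) = w (j + e + t)" by (simp add: add.assoc)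
qed

lemma local_matrix_closed: "local_matrix N a \<Longrightarrow> a i j \<in> carrier K"
  and local_matrix_outside: "local_matrix N a \<Longrightarrow> int N < \<bar>i - j\<bar> \<Longrightarrow> a i j = \<zero>"
  and local_matrix_agree: "local_matrix N a \<Longrightarrow> agree N i i' \<Longrightarrow> a i (i + d) = a i' (i' + d)"
  unfolding local_matrix_def by blast+

lemma local_matrix_mono: "local_matrix N a \<Longrightarrow> N \<le> M \<Longrightarrow> local_matrix M a"
  unfolding local_matrix_def by (meson agree_mono le_less_trans of_nat_mono)

lemma local_matrix_support: "local_matrix N a \<Longrightarrow> {l. a i l \<noteq> \<zero>} \<subseteq> {i - int N..i + int N}"
proof
  fix l assume "local_matrix N a" and l: "l \<in> {l. a i l \<noteq> \<zero>}"
  then have "\<not> int N < \<bar>i - l\<bar>" using local_matrix_outside by blast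
  then show "l \<in> {i - int N..i + int N}" by auto
qed

lemma in_alg: "a \<in> carrier alg \<longleftrightarrow> (\<exists>N. local_matrix N a)"
  by (simp add: alg_def)

lemma in_algI: "local_matrix N a \<Longrightarrow> a \<in> carrier alg"
  by (auto simp: in_alg)

lemma alg_closed: "a \<in> carrier alg \<Longrightarrow> a i j \<in> carrier K"
  using local_matrix_closed by (auto simp: in_alg)

lemma add_entry: "(a \<oplus>\<^bsub>alg\<^esub> b) i j = a i j \<oplus> b i j"
  and smult_entry: "(c \<odot>\<^bsub>alg\<^esub> a) i j = c \<otimes> a i j"
  and zero_entry: "\<zero>\<^bsub>alg\<^esub> i j = \<zero>"
  and one_entry: "\<one>\<^bsub>alg\<^esub> i j = (if i = j then \<one> else \<zero>)"
  by (simp_all add: alg_def)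

lemma mult_entry_superset:
  assumes "\<And>l. a i l \<in> carrier K" "\<And>l. b l j \<in> carrier K"
    and "finite S" "{l. a i l \<noteq> \<zero>} \<subseteq> S"
  shows "(a \<otimes>\<^bsub>alg\<^esub> b) i j = (\<Oplus>l\<in>S. a i l \<otimes> b l j)"
proof -
  have "(\<Oplus>l\<in>{l. a i l \<noteq> \<zero>}. a i l \<otimes> b l j) = (\<Oplus>l\<in>S. a i l \<otimes> b l j)"
    using assms by (intro add.finprod_mono_neutral_cong_left) auto
  then show ?thesis by (simp add: alg_def)
qed

lemma mult_entry:
  assumes "local_matrix N a" "local_matrix M b"
  shows "(a \<otimes>\<^bsub>alg\<^esub> b) i j = (\<Oplus>l\<in>{i - int N..i + int N}. a i l \<otimes> b l j)"
  using assms by (intro mult_entry_superset)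
    (auto simp: local_matrix_closed dest: local_matrix_support)

lemma local_matrix_add:
  assumes a: "local_matrix N a" and b: "local_matrix N b" shows "local_matrix N (a \<oplus>\<^bsub>alg\<^esub> b)"
proof -
  have "a i j \<oplus> b i j \<in> carrier K" for i j
    using local_matrix_closed[OF a] local_matrix_closed[OF b] by simp
  moreover have "int N < \<bar>i - j\<bar> \<Longrightarrow> a i j \<oplus> b i j = \<zero>" for i j
    using local_matrix_outside[OF a] local_matrix_outside[OF b] by simp
  moreover have "agree N i i' \<Longrightarrow> a i (i + d) \<oplus> b i (i + d) = a i' (i' + d) \<oplus> b i' (i' + d)" for i i' d
    by (rule arg_cong2[OF local_matrix_agree[OF a] local_matrix_agree[OF b]])
  ultimately show ?thesis unfolding local_matrix_def add_entry by blast
qed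

lemma local_matrix_smult:
  assumes "local_matrix N a" "c \<in> carrier K" shows "local_matrix N (c \<odot>\<^bsub>alg\<^esub> a)"
proof -
  have "agree N i i' \<Longrightarrow> c \<otimes> a i (i + d) = c \<otimes> a i' (i' + d)" for i i' d
    by (rule arg_cong[OF local_matrix_agree[OF assms(1)]])
  moreover have "int N < \<bar>i - j\<bar> \<Longrightarrow> c \<otimes> a i j = \<zero>" for i j
    using local_matrix_outside[OF assms(1)] assms(2) by simp
  moreover have "c \<otimes> a i j \<in> carrier K" for i j
    using local_matrix_closed[OF assms(1)] assms(2) by simp
  ultimately show ?thesis unfolding local_matrix_def smult_entry by blast
qed

lemma local_matrix_zero: "local_matrix N \<zero>\<^bsub>alg\<^esub>"
  unfolding local_matrix_def zero_entry by auto

text \<open>In the product, the entry in row \<open>i\<close> uses rows \<open>i + e\<close> of the second factor with \<open>\<bar>e\<bar> \<le> N\<close>, whose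
  windows of radius \<open>M\<close> lie inside the window of radius \<open>N + M\<close> around \<open>i\<close>.\<close>

lemma local_matrix_mult:
  assumes a: "local_matrix N a" and b: "local_matrix M b"
  shows "local_matrix (N + M) (a \<otimes>\<^bsub>alg\<^esub> b)"
proof -
  note ac = local_matrix_closed[OF a] and bc = local_matrix_closed[OF b]
  have "(\<Oplus>l\<in>S. a i l \<otimes> b l j) \<in> carrier K" for S i j
    using ac bc by (intro finsum_closed) auto
  moreover have "(\<Oplus>l\<in>{i - int N..i + int N}. a i l \<otimes> b l j) = \<zero>" if "int (N + M) < \<bar>i - j\<bar>" for i j
  proof (rule add.finprod_one_eqI)
    fix l assume "l \<in> {i - int N..i + int N}"
    then have "int M < \<bar>l - j\<bar>" using that by auto
    then show "a i l \<otimes> b l j = \<zero>" using local_matrix_outside[OF b] ac by simp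
  qed
  moreover have "(\<Oplus>l\<in>{i - int N..i + int N}. a i l \<otimes> b l (i + d)) =
      (\<Oplus>l\<in>{i' - int N..i' + int N}. a i' l \<otimes> b l (i' + d))" if "agree (N + M) i i'" for i i' d
  proof -
    have *: "(\<Oplus>l\<in>{i - int N..i + int N}. a i l \<otimes> b l (i + d)) =
        (\<Oplus>e\<in>{- int N..int N}. a i (i + e) \<otimes> b (i + e) (i + e + (d - e)))" for i
    proof -
      have "{i - int N..i + int N} = (\<lambda>e. i + e) ` {- int N..int N}" by simp
      then show ?thesis using ac bc by (simp only:) (subst finsum_reindex, auto simp: inj_on_def)
    qed
    show ?thesis unfolding * 
    proof (rule finsum_cong')
      fix e assume "e \<in> {- int N..int N}"
      then have "int M + \<bar>e\<bar> \<le> int (N + M)" by auto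
      then have 2: "agree M (i + e) (i' + e)" using that by (rule agree_shift[rotated])
      have 1: "agree N i i'" using that by (rule agree_mono) simp
      show "a i (i + e) \<otimes> b (i + e) (i + e + (d - e)) = a i' (i' + e) \<otimes> b (i' + e) (i' + e + (d - e))"
        by (rule arg_cong2[OF local_matrix_agree[OF a 1] local_matrix_agree[OF b 2]])
    qed (use ac bc in auto)
  qed
  ultimately show ?thesis unfolding local_matrix_def mult_entry[OF a b] by blast
qed

lemma local_matrix_shift:
  assumes "local_set N f" "\<bar>d\<bar> \<le> int N" shows "local_matrix N (shift_matrix f d)"
  using assms unfolding local_matrix_def shift_matrix_def local_set_def by auto

lemma one_eq_shift: "\<one>\<^bsub>alg\<^esub> = shift_matrix (\<lambda>i. True) 0"
  by (auto simp: shift_matrix_def alg_def fun_eq_iff)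

lemma local_matrix_one: "local_matrix N \<one>\<^bsub>alg\<^esub>"
  unfolding one_eq_shift by (rule local_matrix_shift) (auto simp: local_set_def)

lemma shift_mult_entry:
  assumes "\<And>l. b l j \<in> carrier K"
  shows "(shift_matrix f d \<otimes>\<^bsub>alg\<^esub> b) i j = (if f i then b (i + d) j else \<zero>)"
proof -
  have "(shift_matrix f d \<otimes>\<^bsub>alg\<^esub> b) i j = (\<Oplus>l\<in>{i + d}. shift_matrix f d i l \<otimes> b l j)"
    using assms by (intro mult_entry_superset) (auto simp: shift_matrix_def)
  also have "\<dots> = (if f i then b (i + d) j else \<zero>)"
    using assms by (simp add: shift_matrix_def)
  finally show ?thesis .
qed

lemma mult_shift_entry:
  assumes a: "local_matrix N a"
  shows "(a \<otimes>\<^bsub>alg\<^esub> shift_matrix f d) i j = (if f (j - d) then a i (j - d) else \<zero>)"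
proof -
  note ac = local_matrix_closed[OF a]
  \<comment> \<open>The column \<open>j - d\<close> may lie outside the band of \<open>a\<close>, where the entry is zero.\<close>
  define S where "S = insert (j - d) {i - int N..i + int N}"
  have "(a \<otimes>\<^bsub>alg\<^esub> shift_matrix f d) i j = (\<Oplus>l\<in>S. a i l \<otimes> shift_matrix f d l j)"
    using local_matrix_support[OF a] ac
    by (intro mult_entry_superset) (auto simp: shift_matrix_def S_def)
  also have "\<dots> = a i (j - d) \<otimes> shift_matrix f d (j - d) j"
    using ac by (intro finsum_eq_single) (auto simp: S_def shift_matrix_def)
  finally show ?thesis using ac by (simp add: shift_matrix_def)
qed

lemma shift_mult_shift:
  "shift_matrix f d \<otimes>\<^bsub>alg\<^esub> shift_matrix g e = shift_matrix (\<lambda>i. f i \<and> g (i + d)) (d + e)"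
proof (intro ext)
  fix i j
  have "(shift_matrix f d \<otimes>\<^bsub>alg\<^esub> shift_matrix g e) i j =
      (if f i then shift_matrix g e (i + d) j else \<zero>)"
    by (rule shift_mult_entry) (simp add: shift_matrix_def)
  then show "(shift_matrix f d \<otimes>\<^bsub>alg\<^esub> shift_matrix g e) i j =
      shift_matrix (\<lambda>i. f i \<and> g (i + d)) (d + e) i j"
    by (auto simp: shift_matrix_def)
qed

lemma mult_assoc:
  assumes a: "local_matrix N a" and b: "local_matrix M b" and c: "local_matrix P c"
  shows "(a \<otimes>\<^bsub>alg\<^esub> b) \<otimes>\<^bsub>alg\<^esub> c = a \<otimes>\<^bsub>alg\<^esub> (b \<otimes>\<^bsub>alg\<^esub> c)"
proof (intro ext)
  fix i j
  note cl = local_matrix_closed[OF a] local_matrix_closed[OF b] local_matrix_closed[OF c]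
  define S where "S = {i - int N..i + int N}"
  define T where "T = {i - int (N + M)..i + int (N + M)}"
  have "((a \<otimes>\<^bsub>alg\<^esub> b) \<otimes>\<^bsub>alg\<^esub> c) i j = (\<Oplus>l\<in>T. (a \<otimes>\<^bsub>alg\<^esub> b) i l \<otimes> c l j)"
    unfolding T_def by (rule mult_entry[OF local_matrix_mult[OF a b] c])
  also have "\<dots> = (\<Oplus>l\<in>T. \<Oplus>m\<in>S. a i m \<otimes> (b m l \<otimes> c l j))"
    unfolding mult_entry[OF a b] S_def[symmetric]
  proof (rule finsum_cong')
    fix l
    have "(\<Oplus>m\<in>S. a i m \<otimes> b m l) \<otimes> c l j = (\<Oplus>m\<in>S. a i m \<otimes> b m l \<otimes> c l j)"
      using cl by (intro finsum_ldistr) (auto simp: S_def)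
    also have "\<dots> = (\<Oplus>m\<in>S. a i m \<otimes> (b m l \<otimes> c l j))"
      using cl by (intro finsum_cong') (auto simp: m_assoc)
    finally show "(\<Oplus>m\<in>S. a i m \<otimes> b m l) \<otimes> c l j = (\<Oplus>m\<in>S. a i m \<otimes> (b m l \<otimes> c l j))" .
  qed (use cl in \<open>auto intro!: finsum_closed\<close>)
  also have "\<dots> = (\<Oplus>m\<in>S. \<Oplus>l\<in>T. a i m \<otimes> (b m l \<otimes> c l j))"
    using cl by (intro finsum_swap) (auto simp: S_def T_def)
  also have "\<dots> = (\<Oplus>m\<in>S. a i m \<otimes> (b \<otimes>\<^bsub>alg\<^esub> c) m j)"
  proof (rule finsum_cong')
    fix m assume m: "m \<in> S"
    have "(b \<otimes>\<^bsub>alg\<^esub> c) m j = (\<Oplus>l\<in>T. b m l \<otimes> c l j)"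
      using cl m local_matrix_support[OF b, of m]
      by (intro mult_entry_superset) (auto simp: S_def T_def)
    then show "(\<Oplus>l\<in>T. a i m \<otimes> (b m l \<otimes> c l j)) = a i m \<otimes> (b \<otimes>\<^bsub>alg\<^esub> c) m j"
      using cl by (simp add: finsum_rdistr T_def)
  qed (use cl local_matrix_closed[OF local_matrix_mult[OF b c]] in auto)
  also have "\<dots> = (a \<otimes>\<^bsub>alg\<^esub> (b \<otimes>\<^bsub>alg\<^esub> c)) i j"
    unfolding S_def by (rule mult_entry[OF a local_matrix_mult[OF b c], symmetric])
  finally show "((a \<otimes>\<^bsub>alg\<^esub> b) \<otimes>\<^bsub>alg\<^esub> c) i j = (a \<otimes>\<^bsub>alg\<^esub> (b \<otimes>\<^bsub>alg\<^esub> c)) i j" .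
qed

lemma common_local:
  assumes "a \<in> carrier alg" "b \<in> carrier alg"
  obtains N where "local_matrix N a" "local_matrix N b"
proof -
  from assms obtain N M where "local_matrix N a" "local_matrix M b" by (auto simp: in_alg)
  then have "local_matrix (max N M) a" "local_matrix (max N M) b"
    by (auto elim: local_matrix_mono)
  then show ?thesis by (rule that)
qed

lemma alg_add_closed: "a \<in> carrier alg \<Longrightarrow> b \<in> carrier alg \<Longrightarrow> a \<oplus>\<^bsub>alg\<^esub> b \<in> carrier alg"
  by (metis common_local local_matrix_add in_algI)

lemma alg_smult_closed: "c \<in> carrier K \<Longrightarrow> a \<in> carrier alg \<Longrightarrow> c \<odot>\<^bsub>alg\<^esub> a \<in> carrier alg"
  by (metis in_alg local_matrix_smult)

lemma alg_mult_closed: "a \<in> carrier alg \<Longrightarrow> b \<in> carrier alg \<Longrightarrow> a \<otimes>\<^bsub>alg\<^esub> b \<in> carrier alg"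
  by (metis in_alg local_matrix_mult)

lemma mult_add_left:
  assumes "a \<in> carrier alg" "b \<in> carrier alg" "c \<in> carrier alg"
  shows "(a \<oplus>\<^bsub>alg\<^esub> b) \<otimes>\<^bsub>alg\<^esub> c = (a \<otimes>\<^bsub>alg\<^esub> c) \<oplus>\<^bsub>alg\<^esub> (b \<otimes>\<^bsub>alg\<^esub> c)"
proof -
  obtain N where N: "local_matrix N a" "local_matrix N b" by (rule common_local[OF assms(1,2)])
  obtain M where M: "local_matrix M c" using assms by (auto simp: in_alg)
  show ?thesis using alg_closed assms
    by (intro ext) (simp add: add_entry mult_entry[OF N(1) M] mult_entry[OF N(2) M]
        mult_entry[OF local_matrix_add[OF N] M] l_distr finsum_addf Pi_def)
qed

lemma mult_add_right:
  assumes "a \<in> carrier alg" "b \<in> carrier alg" "c \<in> carrier alg"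
  shows "c \<otimes>\<^bsub>alg\<^esub> (a \<oplus>\<^bsub>alg\<^esub> b) = (c \<otimes>\<^bsub>alg\<^esub> a) \<oplus>\<^bsub>alg\<^esub> (c \<otimes>\<^bsub>alg\<^esub> b)"
proof -
  obtain N where N: "local_matrix N a" "local_matrix N b" by (rule common_local[OF assms(1,2)])
  obtain M where M: "local_matrix M c" using assms by (auto simp: in_alg)
  show ?thesis using alg_closed assms
    by (intro ext) (simp add: add_entry mult_entry[OF M N(1)] mult_entry[OF M N(2)]
        mult_entry[OF M local_matrix_add[OF N]] r_distr finsum_addf Pi_def)
qed

lemma smult_mult:
  assumes "a \<in> carrier alg" "b \<in> carrier alg" "c \<in> carrier K"
  shows "(c \<odot>\<^bsub>alg\<^esub> a) \<otimes>\<^bsub>alg\<^esub> b = c \<odot>\<^bsub>alg\<^esub> (a \<otimes>\<^bsub>alg\<^esub> b)"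
    and "a \<otimes>\<^bsub>alg\<^esub> (c \<odot>\<^bsub>alg\<^esub> b) = c \<odot>\<^bsub>alg\<^esub> (a \<otimes>\<^bsub>alg\<^esub> b)"
proof -
  obtain N where N: "local_matrix N a" "local_matrix N b" by (rule common_local[OF assms(1,2)])
  note cl = alg_closed[OF assms(1)] alg_closed[OF assms(2)] assms(3)
  show "(c \<odot>\<^bsub>alg\<^esub> a) \<otimes>\<^bsub>alg\<^esub> b = c \<odot>\<^bsub>alg\<^esub> (a \<otimes>\<^bsub>alg\<^esub> b)"
    using cl by (intro ext) (simp add: smult_entry mult_entry[OF N]
        mult_entry[OF local_matrix_smult[OF N(1) assms(3)] N(2)] m_assoc finsum_rdistr)
  show "a \<otimes>\<^bsub>alg\<^esub> (c \<odot>\<^bsub>alg\<^esub> b) = c \<odot>\<^bsub>alg\<^esub> (a \<otimes>\<^bsub>alg\<^esub> b)"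
    using cl by (intro ext) (simp add: smult_entry mult_entry[OF N]
        mult_entry[OF N(1) local_matrix_smult[OF N(2) assms(3)]] m_lcomm finsum_rdistr)
qed

lemma abelian_group_alg: "abelian_group alg"
proof (rule abelian_groupI)
  fix a assume a: "a \<in> carrier alg"
  then have "\<ominus> \<one> \<odot>\<^bsub>alg\<^esub> a \<in> carrier alg" by (simp add: alg_smult_closed)
  moreover have "(\<ominus> \<one> \<odot>\<^bsub>alg\<^esub> a) \<oplus>\<^bsub>alg\<^esub> a = \<zero>\<^bsub>alg\<^esub>"
    using alg_closed[OF a]
    by (intro ext) (simp add: add_entry smult_entry zero_entry l_minus l_neg)
  ultimately show "\<exists>b\<in>carrier alg. b \<oplus>\<^bsub>alg\<^esub> a = \<zero>\<^bsub>alg\<^esub>" by blast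
qed (auto simp: alg_add_closed alg_closed in_algI[OF local_matrix_zero] fun_eq_iff add_entry
    zero_entry a_ac)

lemma ring_alg: "ring alg"
proof (rule ring.intro)
  show "abelian_group alg" by (rule abelian_group_alg)
  show "Group.monoid alg"
  proof (rule Group.monoidI)
    fix a assume a: "a \<in> carrier alg"
    then obtain N where N: "local_matrix N a" by (auto simp: in_alg)
    show "\<one>\<^bsub>alg\<^esub> \<otimes>\<^bsub>alg\<^esub> a = a" unfolding one_eq_shift
      by (intro ext) (simp add: shift_mult_entry alg_closed[OF a])
    show "a \<otimes>\<^bsub>alg\<^esub> \<one>\<^bsub>alg\<^esub> = a" unfolding one_eq_shift
      by (intro ext) (simp add: mult_shift_entry[OF N])
  next
    show "\<one>\<^bsub>alg\<^esub> \<in> carrier alg" by (rule in_algI[OF local_matrix_one])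
  next
    fix a b c assume "a \<in> carrier alg" "b \<in> carrier alg" "c \<in> carrier alg"
    then show "a \<otimes>\<^bsub>alg\<^esub> b \<otimes>\<^bsub>alg\<^esub> c = a \<otimes>\<^bsub>alg\<^esub> (b \<otimes>\<^bsub>alg\<^esub> c)"
      by (metis in_alg mult_assoc)
  qed (rule alg_mult_closed)
  show "ring_axioms alg"
    by (rule ring_axioms.intro) (simp_all add: mult_add_left mult_add_right)
qed

lemma unital_algebra_alg: "unital_algebra K alg"
proof (intro unital_algebra.intro unital_algebra_axioms.intro)
  show "vectorspace K alg"
  proof (intro vectorspace.intro module.intro module_axioms.intro)
    show "cring K" by (rule is_cring)
    show "field K" by (rule field_axioms)
    show "abelian_group alg" by (rule abelian_group_alg)
  qed (auto simp: alg_smult_closed alg_closed fun_eq_iff add_entry smult_entry l_distr r_distr m_assoc)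
  show "ring alg" by (rule ring_alg)
qed (simp_all add: smult_mult)

end

section \<open>Simplicity\<close>

context word_matrices
begin

lemma shift_in_alg: "local_set N f \<Longrightarrow> shift_matrix f d \<in> carrier alg"
proof -
  assume "local_set N f"
  then have "local_set (max N (nat \<bar>d\<bar>)) f"
    unfolding local_set_def using agree_mono by (meson max.cobounded1)
  then have "local_matrix (max N (nat \<bar>d\<bar>)) (shift_matrix f d)"
    by (rule local_matrix_shift) simp
  then show ?thesis by (rule in_algI)
qed

lemma agree_sym: "agree N i j \<Longrightarrow> agree N j i"
  by (simp add: agree_def)

lemma agree_trans: "agree N i j \<Longrightarrow> agree N j k \<Longrightarrow> agree N i k"
  by (simp add: agree_def)

lemma local_set_agree: "local_set N (agree N i)"
  unfolding local_set_def using agree_sym agree_trans by blast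

lemma local_set_translate:
  assumes "local_set N f" shows "local_set (N + nat \<bar>e\<bar>) (\<lambda>i. f (i + e))"
  unfolding local_set_def
proof (intro allI impI)
  fix i j assume "agree (N + nat \<bar>e\<bar>) i j"
  then have "agree N (i + e) (j + e)" by (rule agree_shift) simp
  then show "f (i + e) = f (j + e)" using assms unfolding local_set_def by blast
qed

lemma local_set_mono: "local_set N f \<Longrightarrow> N \<le> M \<Longrightarrow> local_set M f"
  unfolding local_set_def using agree_mono by blast

text \<open>If each letter recurs along an arithmetic progression, then a finite window recurs along the
  product of the finitely many steps.\<close>

lemma window_recurs:
  assumes "\<And>i. \<exists>q>0. \<forall>t. w (i + q * t) = w i"
  shows "\<exists>q>0. \<forall>t. agree N i (i + q * t)"
proof -
  have "\<exists>q>0. \<forall>t. \<forall>s\<in>S. w (i + s + q * t) = w (i + s)" if "finite S" for S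
    using that
  proof (induction S rule: finite_induct)
    case empty
    show ?case by (intro exI[of _ 1]) simp
  next
    case (insert s S)
    then obtain q where q: "q > 0" "\<And>t s. s \<in> S \<Longrightarrow> w (i + s + q * t) = w (i + s)" by blast
    obtain p where p: "p > 0" "\<And>t. w (i + s + p * t) = w (i + s)" using assms by blast
    have "w (i + u + (q * p) * t) = w (i + u)" if "u \<in> insert s S" for u t
      using that q(2)[of u "p * t"] p(2)[of "q * t"] by (auto simp: ac_simps)
    then show ?case using q(1) p(1) by (intro exI[of _ "q * p"]) auto
  qed
  from this[of "{- int N..int N}"] obtain q where q: "q > 0"
    "\<And>t s. s \<in> {- int N..int N} \<Longrightarrow> w (i + s + q * t) = w (i + s)" by auto
  have "agree N i (i + q * t)" for t
    unfolding agree_def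
  proof (intro allI impI)
    fix s assume "\<bar>s\<bar> \<le> int N"
    then have "s \<in> {- int N..int N}" by auto
    from q(2)[OF this, of t] show "w (i + s) = w (i + q * t + s)" by (simp add: ac_simps)
  qed
  then show ?thesis using q(1) by blast
qed

lemma smult_in_ideal:
  assumes "ideal I alg" "x \<in> I" "c \<in> carrier K"
  shows "c \<odot>\<^bsub>alg\<^esub> x \<in> I"
proof -
  interpret I: ideal I alg by fact
  have x: "x \<in> carrier alg" using assms(2) by (rule I.a_Hcarr)
  have o: "\<one>\<^bsub>alg\<^esub> \<in> carrier alg" by (rule in_algI[OF local_matrix_one])
  have "c \<odot>\<^bsub>alg\<^esub> x = c \<odot>\<^bsub>alg\<^esub> (\<one>\<^bsub>alg\<^esub> \<otimes>\<^bsub>alg\<^esub> x)" using x by (simp add: I.l_one)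
  also have "\<dots> = (c \<odot>\<^bsub>alg\<^esub> \<one>\<^bsub>alg\<^esub>) \<otimes>\<^bsub>alg\<^esub> x" using smult_mult(1)[OF o x assms(3)] by simp
  also have "\<dots> \<in> I" using assms(2) alg_smult_closed[OF assms(3) o] by (rule I.I_l_closed)
  finally show ?thesis .
qed

text \<open>Moving a nonzero entry of an element of the ideal to the diagonal yields \<open>b\<close> of some range \<open>N\<close>.
  Compressing \<open>b\<close> to the occurrences of a window that does not return within distance \<open>N\<close> kills all entries off the
  diagonal, and on the diagonal leaves the single value \<open>c\<close>.\<close>

lemma ideal_contains_window:
  assumes sep: "\<And>N. \<exists>M. \<forall>i j. agree M i j \<longrightarrow> i \<noteq> j \<longrightarrow> int N < \<bar>i - j\<bar>"
    and I: "ideal I alg" "I \<noteq> {\<zero>\<^bsub>alg\<^esub>}"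
  shows "\<exists>M i. shift_matrix (agree M i) 0 \<in> I"
proof -
  interpret I: ideal I alg by fact
  have "\<zero>\<^bsub>alg\<^esub> \<in> I" by simp
  then obtain a where a: "a \<in> I" "a \<noteq> \<zero>\<^bsub>alg\<^esub>" using I(2) by blast
  then obtain i j where ij: "a i j \<noteq> \<zero>" using zero_entry by (metis ext)
  obtain N0 where N0: "local_matrix N0 a" using I.a_Hcarr[OF a(1)] by (auto simp: in_alg)
  define b where "b = a \<otimes>\<^bsub>alg\<^esub> shift_matrix (\<lambda>_. True) (i - j)"
  have "b \<in> I" unfolding b_def
    using a(1) by (rule I.I_r_closed) (rule shift_in_alg, simp add: local_set_def)
  then obtain N where N: "local_matrix N b" using I.a_Hcarr by (auto simp: in_alg)
  define c where "c = b i i"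
  have c: "c \<noteq> \<zero>" "c \<in> carrier K"
    using ij N unfolding c_def by (simp add: b_def mult_shift_entry[OF N0], simp add: local_matrix_closed)
  obtain M0 where M0: "\<And>x y. agree M0 x y \<Longrightarrow> x \<noteq> y \<Longrightarrow> int N < \<bar>x - y\<bar>" using sep by blast
  define M where "M = max M0 N"
  define P where "P = shift_matrix (agree M i) 0"
  have P: "P \<in> carrier alg" unfolding P_def by (rule shift_in_alg[OF local_set_agree])
  then obtain L where L: "local_matrix L P" by (auto simp: in_alg)
  have "P \<otimes>\<^bsub>alg\<^esub> b \<otimes>\<^bsub>alg\<^esub> P = c \<odot>\<^bsub>alg\<^esub> P"
  proof (intro ext)
    fix x y
    have "(P \<otimes>\<^bsub>alg\<^esub> b \<otimes>\<^bsub>alg\<^esub> P) x y = (if agree M i y then (if agree M i x then b x y else \<zero>) else \<zero>)"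
      unfolding P_def mult_shift_entry[OF local_matrix_mult[OF L[unfolded P_def] N]]
      using local_matrix_closed[OF N] by (simp add: shift_mult_entry)
    also have "\<dots> = (if x = y \<and> agree M i x then c else \<zero>)"
    proof (cases "agree M i x \<and> agree M i y")
      case True
      then have xy: "agree M x y" using agree_sym agree_trans by blast
      show ?thesis
      proof (cases "x = y")
        case True
        have "agree N i x" using \<open>agree M i x \<and> agree M i y\<close> agree_mono by (auto simp: M_def)
        then have "b i (i + 0) = b x (x + 0)" by (rule local_matrix_agree[OF N])
        then show ?thesis using True by (auto simp: c_def)
      next
        case False
        then have "int N < \<bar>x - y\<bar>" using M0[of x y] xy agree_mono by (auto simp: M_def)
        then have "b x y = \<zero>" by (rule local_matrix_outside[OF N])
        then show ?thesis using False by simp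
      qed
    qed auto
    also have "\<dots> = (c \<odot>\<^bsub>alg\<^esub> P) x y"
      using c by (simp add: smult_entry P_def shift_matrix_def)
    finally show "(P \<otimes>\<^bsub>alg\<^esub> b \<otimes>\<^bsub>alg\<^esub> P) x y = (c \<odot>\<^bsub>alg\<^esub> P) x y" .
  qed
  moreover have "P \<otimes>\<^bsub>alg\<^esub> b \<otimes>\<^bsub>alg\<^esub> P \<in> I"
    using \<open>b \<in> I\<close> P by (intro I.I_l_closed I.I_r_closed)
  ultimately have "c \<odot>\<^bsub>alg\<^esub> P \<in> I" by simp
  moreover have "c \<in> Units K" using c by (simp add: field_Units)
  then have ic: "inv c \<in> carrier K" "inv c \<otimes> c = \<one>" by simp_all
  ultimately have "inv c \<odot>\<^bsub>alg\<^esub> (c \<odot>\<^bsub>alg\<^esub> P) \<in> I" using smult_in_ideal I(1) by blast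
  moreover have "inv c \<odot>\<^bsub>alg\<^esub> (c \<odot>\<^bsub>alg\<^esub> P) = P"
    using ic c alg_closed[OF P] by (intro ext) (simp add: smult_entry m_assoc[symmetric])
  ultimately show ?thesis unfolding P_def by metis
qed

text \<open>The indicator of \<open>f \<or> g\<close> is the sum of the indicators of \<open>f\<close> and of \<open>\<not> f \<and> g\<close>.\<close>

lemma ideal_contains_union:
  assumes "ideal I alg" and f: "local_set N f" "shift_matrix f 0 \<in> I" and g: "shift_matrix g 0 \<in> I"
  shows "shift_matrix (\<lambda>i. f i \<or> g i) 0 \<in> I"
proof -
  interpret I: ideal I alg by fact
  have "local_set N (\<lambda>i. \<not> f i)" using f(1) by (simp add: local_set_def)
  then have "shift_matrix (\<lambda>i. \<not> f i) 0 \<in> carrier alg" by (rule shift_in_alg)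
  then have "shift_matrix (\<lambda>i. \<not> f i) 0 \<otimes>\<^bsub>alg\<^esub> shift_matrix g 0 \<in> I" by (rule I.I_l_closed[OF g])
  with f(2) have "shift_matrix f 0 \<oplus>\<^bsub>alg\<^esub> (shift_matrix (\<lambda>i. \<not> f i) 0 \<otimes>\<^bsub>alg\<^esub> shift_matrix g 0) \<in> I"
    by (rule additive_subgroup.a_closed[OF I.additive_subgroup_axioms])
  moreover have "shift_matrix f 0 \<oplus>\<^bsub>alg\<^esub> (shift_matrix (\<lambda>i. \<not> f i) 0 \<otimes>\<^bsub>alg\<^esub> shift_matrix g 0) =
      shift_matrix (\<lambda>i. f i \<or> g i) 0"
    unfolding shift_mult_shift by (intro ext) (auto simp: add_entry shift_matrix_def)
  ultimately show ?thesis by simp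
qed

text \<open>Conjugation by a translation.\<close>

lemma ideal_contains_translate:
  assumes "ideal I alg" "shift_matrix f 0 \<in> I"
  shows "shift_matrix (\<lambda>i. f (i + e)) 0 \<in> I"
proof -
  interpret I: ideal I alg by fact
  have t: "shift_matrix (\<lambda>_. True) d \<in> carrier alg" for d
    by (rule shift_in_alg) (simp add: local_set_def)
  have "shift_matrix (\<lambda>_. True) e \<otimes>\<^bsub>alg\<^esub> shift_matrix f 0 \<otimes>\<^bsub>alg\<^esub> shift_matrix (\<lambda>_. True) (- e) \<in> I"
    using assms(2) t by (intro I.I_l_closed I.I_r_closed)
  then show ?thesis by (simp add: shift_mult_shift)
qed

theorem simple_alg:
  assumes toeplitz: "\<And>i. \<exists>q>0. \<forall>t. w (i + q * t) = w i"
    and sep: "\<And>N. \<exists>M. \<forall>i j. agree M i j \<longrightarrow> i \<noteq> j \<longrightarrow> int N < \<bar>i - j\<bar>"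
  shows "simple_algebra alg"
  unfolding simple_algebra_def
proof (intro conjI allI impI)
  have "\<one>\<^bsub>alg\<^esub> 0 0 \<noteq> \<zero>\<^bsub>alg\<^esub> 0 0" by (simp add: one_entry zero_entry)
  then have "\<one>\<^bsub>alg\<^esub> \<noteq> \<zero>\<^bsub>alg\<^esub>" by metis
  then show "carrier alg \<noteq> {\<zero>\<^bsub>alg\<^esub>}" using in_algI[OF local_matrix_one] by blast
next
  fix I assume I: "ideal I alg"
  interpret I: ideal I alg by fact
  show "I = {\<zero>\<^bsub>alg\<^esub>} \<or> I = carrier alg"
  proof (cases "I = {\<zero>\<^bsub>alg\<^esub>}")
    case False
    with ideal_contains_window[OF sep I] obtain M i where P: "shift_matrix (agree M i) 0 \<in> I" by blast
    obtain q where q: "q > 0" "\<And>t. agree M i (i + q * t)" using window_recurs[OF toeplitz] by blast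
    define f where "f = (\<lambda>(n::nat) x. \<exists>r<n. agree M i (x + int r))"
    have "shift_matrix (f n) 0 \<in> I \<and> local_set (M + n) (f n)" for n
    proof (induction n)
      case 0
      have "shift_matrix (f 0) 0 = \<zero>\<^bsub>alg\<^esub>"
        by (auto simp: f_def shift_matrix_def fun_eq_iff zero_entry)
      then show ?case by (simp add: f_def local_set_def)
    next
      case (Suc n)
      have e: "f (Suc n) = (\<lambda>x. f n x \<or> agree M i (x + int n))"
        by (auto simp: f_def less_Suc_eq fun_eq_iff)
      have 1: "shift_matrix (f (Suc n)) 0 \<in> I" unfolding e
        using I Suc ideal_contains_translate[OF I P] ideal_contains_union by blast
      have "local_set (M + Suc n) (f n)" using Suc by (auto intro: local_set_mono)
      moreover have "local_set (M + nat \<bar>int n\<bar>) (\<lambda>x. agree M i (x + int n))"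
        by (rule local_set_translate[OF local_set_agree])
      then have "local_set (M + Suc n) (\<lambda>x. agree M i (x + int n))" by (rule local_set_mono) simp
      ultimately have "local_set (M + Suc n) (f (Suc n))" unfolding e local_set_def by blast
      with 1 show ?case by blast
    qed
    then have "shift_matrix (f (nat q)) 0 \<in> I" by blast
    moreover have "f (nat q) x" for x
    proof -
      \<comment> \<open>The translates by the residues modulo the recurrence step cover all positions.\<close>
      define r where "r = nat ((i - x) mod q)"
      have r: "int r = (i - x) mod q" using q(1) by (simp add: r_def)
      then have "int r < q" using q(1) by simp
      then have "r < nat q" by linarith
      moreover have "x + int r = i + q * (- ((i - x) div q))"
        unfolding r using minus_mult_div_eq_mod[of "i - x" q] by (simp add: algebra_simps)
      then have "agree M i (x + int r)" using q(2) by metis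
      ultimately show ?thesis unfolding f_def by blast
    qed
    then have "f (nat q) = (\<lambda>_. True)" by blast
    ultimately have "\<one>\<^bsub>alg\<^esub> \<in> I" by (simp add: one_eq_shift)
    then show ?thesis using I.one_imp_carrier by simp
  qed simp
qed

end

section \<open>Dimensions of subspaces\<close>

context vectorspace
begin

text \<open>The dimension is defined through finite generating sets, and a subspace does not inherit one
  directly. The exchange argument bounds its independent sets by \<open>card B\<close>, so a maximal one exists and is a basis.\<close>

lemma finite_basis_in_spanned:
  assumes W: "subspace K W V" and B: "finite B" "B \<subseteq> carrier V" "W \<subseteq> span B"
  shows "vectorspace.fin_dim K (vs W)" "vectorspace.dim K (vs W) \<le> card B"
proof -
  interpret W: vectorspace K "vs W" using W by (rule subspace_is_vs)
  have sm: "submodule K W V" using W by simp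
  have WV: "W \<subseteq> carrier V" using sm by (rule submodule.subset)
  have small: "finite S \<and> card S \<le> card B" if "S \<subseteq> carrier (vs W) \<and> W.lin_indpt S" for S
  proof -
    have fin: "card T \<le> card B" if "finite T" "T \<subseteq> W" "lin_indpt T" for T
    proof -
      have "T \<subseteq> span B" using that B(3) by blast
      from replacement[OF that(1) B(1,2) that(3) this] show ?thesis by auto
    qed
    have S: "S \<subseteq> W" "lin_indpt S" using that span_li_not_depend(2)[OF _ sm] by auto
    have "finite S"
    proof (rule ccontr)
      assume "infinite S"
      then obtain T where "T \<subseteq> S" "finite T" "card T = card B + 1"
        by (metis infinite_arbitrarily_large)
      moreover have "lin_indpt T" using \<open>T \<subseteq> S\<close> S(2) subset_li_is_li by blast
      ultimately show False using fin[of T] S(1) by auto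
    qed
    then show ?thesis using fin S by blast
  qed
  have "{} \<subseteq> carrier (vs W) \<and> W.lin_indpt {}" by (simp add: W.lin_dep_def)
  with maximal_exists[of "\<lambda>S. S \<subseteq> carrier (vs W) \<and> W.lin_indpt S", OF small]
  obtain C where C: "maximal C (\<lambda>S. S \<subseteq> carrier (vs W) \<and> W.lin_indpt S)" by blast
  then have bas: "W.basis C" by (rule W.max_li_is_basis)
  have Cc: "C \<subseteq> carrier (vs W) \<and> W.lin_indpt C" using C unfolding maximal_def by blast
  then have "finite C" "card C \<le> card B" using small by auto
  then show "W.dim \<le> card B" using W.dim_basis[OF _ bas] by simp
  show "W.fin_dim" unfolding W.fin_dim_def using bas \<open>finite C\<close> unfolding W.basis_def by blast
qed

lemma card_le_dim_subspace:
  assumes W: "subspace K W V" and B: "finite B" "B \<subseteq> carrier V" "W \<subseteq> span B"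
    and L: "L \<subseteq> W" "lin_indpt L"
  shows "card L \<le> vectorspace.dim K (vs W)"
proof -
  interpret W: vectorspace K "vs W" using W by (rule subspace_is_vs)
  have sm: "submodule K W V" using W by simp
  have "W.lin_indpt L" using L span_li_not_depend(2)[OF L(1) sm] by simp
  then show ?thesis
    using W.li_le_dim(2)[OF finite_basis_in_spanned(1)[OF W B]] L(1) by simp
qed

lemma subspace_of_finsum:
  assumes "submodule K W V" "finite S" "\<And>s. s \<in> S \<Longrightarrow> f s \<in> W"
  shows "finsum V f S \<in> W"
  using assms(2,3)
proof (induction S rule: finite_induct)
  case empty
  then show ?case using submodule.zero_closed[OF assms(1)] by simp
next
  case (insert s S)
  have "f \<in> insert s S \<rightarrow> carrier V" using insert.prems submodule.subset[OF assms(1)] by blast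
  then have "finsum V f (insert s S) = f s \<oplus>\<^bsub>V\<^esub> finsum V f S"
    using insert.hyps by (intro M.finsum_insert) auto
  then show ?case using insert submodule.m_closed[OF assms(1)] by simp
qed

end

section \<open>Growth of a finitely generated algebra\<close>

context unital_algebra
begin

definition list_prod :: "'c list \<Rightarrow> 'c" where
  "list_prod as = foldr (\<otimes>) as \<one>"

definition products :: "'c set \<Rightarrow> nat \<Rightarrow> 'c set" where
  "products S n = {list_prod as | as. length as = n \<and> set as \<subseteq> S}"

lemma list_prod_closed: "set as \<subseteq> carrier A \<Longrightarrow> list_prod as \<in> carrier A"
  unfolding list_prod_def by (induction as) auto

lemma list_prod_append:
  "set as \<subseteq> carrier A \<Longrightarrow> set bs \<subseteq> carrier A \<Longrightarrow> list_prod (as @ bs) = list_prod as \<otimes> list_prod bs"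
proof (induction as)
  case Nil
  then show ?case using list_prod_closed[of bs] by (simp add: list_prod_def)
next
  case (Cons a as)
  then show ?case using list_prod_closed[of bs] list_prod_closed[of as]
    by (simp add: list_prod_def A.m_assoc)
qed

lemma products_closed: "S \<subseteq> carrier A \<Longrightarrow> products S n \<subseteq> carrier A"
  unfolding products_def using list_prod_closed by blast

lemma products_mult:
  assumes "S \<subseteq> carrier A" "x \<in> products S m" "y \<in> products S n"
  shows "x \<otimes> y \<in> products S (m + n)"
proof -
  from assms(2,3) obtain as bs where "x = list_prod as" "length as = m" "set as \<subseteq> S"
    "y = list_prod bs" "length bs = n" "set bs \<subseteq> S" unfolding products_def by blast
  moreover from this have "x \<otimes> y = list_prod (as @ bs)"
    using assms(1) list_prod_append[of as bs] by (metis subset_trans)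
  ultimately show ?thesis unfolding products_def
    by (intro CollectI exI[of _ "as @ bs"]) auto
qed

lemma products_one: "\<one> \<in> S \<Longrightarrow> \<one> \<in> products S n"
  unfolding products_def list_prod_def
  by (intro CollectI exI[of _ "replicate n \<one>"]) (induction n, auto)

lemma products_single: "S \<subseteq> carrier A \<Longrightarrow> x \<in> S \<Longrightarrow> x \<in> products S 1"
  unfolding products_def list_prod_def by (intro CollectI exI[of _ "[x]"]) auto

lemma products_mono:
  assumes "S \<subseteq> carrier A" "\<one> \<in> S" "m \<le> n" shows "products S m \<subseteq> products S n"
proof
  fix x assume x: "x \<in> products S m"
  then have "x \<otimes> \<one> \<in> products S (m + (n - m))"
    using assms products_one by (intro products_mult) auto
  moreover have "x \<in> carrier A" using x products_closed assms(1) by blast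
  ultimately show "x \<in> products S n" using assms(3) by simp
qed

lemma power_space_eq: "power_space K A V n = span (products V n)"
  unfolding power_space_def products_def list_prod_def by simp

text \<open>The product is bilinear: for fixed \<open>x\<close>, the elements \<open>y\<close> with \<open>x \<otimes> y \<in> W\<close> form a subspace, and likewise on the
  other side.\<close>

lemma span_mult:
  assumes X: "X \<subseteq> carrier A" and Y: "Y \<subseteq> carrier A" and W: "submodule K W A"
    and XY: "\<And>x y. x \<in> X \<Longrightarrow> y \<in> Y \<Longrightarrow> x \<otimes> y \<in> W"
    and "x \<in> span X" "y \<in> span Y"
  shows "x \<otimes> y \<in> W"
proof -
  have mod: "module K A" by (rule module_axioms)
  note Wc = submodule.m_closed[OF W] submodule.smult_closed[OF W] submodule.zero_closed[OF W]
  have 1: "x \<otimes> y \<in> W" if x: "x \<in> X" and y: "y \<in> span Y" for x y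
  proof -
    have xc: "x \<in> carrier A" using x X by blast
    have "submodule K {y \<in> carrier A. x \<otimes> y \<in> W} A"
      by (rule submodule.intro[OF mod])
        (use xc Wc in \<open>auto simp: A.r_distr smult_mult_right\<close>)
    moreover have "Y \<subseteq> {y \<in> carrier A. x \<otimes> y \<in> W}" using XY x Y by blast
    ultimately have "span Y \<subseteq> {y \<in> carrier A. x \<otimes> y \<in> W}" by (rule span_is_subset[rotated])
    then show ?thesis using y by blast
  qed
  have yc: "y \<in> carrier A" using assms(6) span_is_subset2[OF Y] by blast
  have "submodule K {x \<in> carrier A. x \<otimes> y \<in> W} A"
    by (rule submodule.intro[OF mod])
      (use yc Wc in \<open>auto simp: A.l_distr smult_mult_left\<close>)
  moreover have "X \<subseteq> {x \<in> carrier A. x \<otimes> y \<in> W}" using 1 assms(6) X by blast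
  ultimately have "span X \<subseteq> {x \<in> carrier A. x \<otimes> y \<in> W}" by (rule span_is_subset[rotated])
  then show ?thesis using assms(5) by blast
qed

lemma power_space_subspace:
  assumes "S \<subseteq> carrier A" shows "subspace K (power_space K A S n) A"
  unfolding power_space_eq using products_closed[OF assms] by (rule span_is_subspace)

lemma power_space_mult:
  assumes S: "S \<subseteq> carrier A" and "x \<in> power_space K A S m" "y \<in> power_space K A S n"
  shows "x \<otimes> y \<in> power_space K A S (m + n)"
proof (rule span_mult)
  show "submodule K (power_space K A S (m + n)) A"
    using power_space_subspace[OF S] by simp
  show "x \<otimes> y \<in> power_space K A S (m + n)" if "x \<in> products S m" "y \<in> products S n" for x y
    using products_mult[OF S that] in_own_span[OF products_closed[OF S]] unfolding power_space_eq by blast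
qed (use assms products_closed in \<open>auto simp: power_space_eq\<close>)

lemma power_space_mono:
  assumes "S \<subseteq> carrier A" "\<one> \<in> S" "m \<le> n"
  shows "power_space K A S m \<subseteq> power_space K A S n"
  unfolding power_space_eq by (rule span_is_monotone[OF products_mono[OF assms]])

lemma subset_power_space:
  assumes "S \<subseteq> carrier A" shows "S \<subseteq> power_space K A S 1"
  unfolding power_space_eq
  using products_single[OF assms] in_own_span[OF products_closed[OF assms]] by blast

text \<open>Applied to a constant \<open>U\<close> for a subalgebra, to the filtration by range, and to the powers of a
  generating space.\<close>

lemma list_prod_in_filtration:
  assumes "\<And>x y m n. x \<in> U m \<Longrightarrow> y \<in> U n \<Longrightarrow> x \<otimes> y \<in> U (m + n)" "\<one> \<in> U 0" "S \<subseteq> U (c::nat)"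
  shows "products S n \<subseteq> U (c * n)"
proof
  fix x assume "x \<in> products S n"
  then obtain as where "x = list_prod as" "length as = n" "set as \<subseteq> S" unfolding products_def by blast
  moreover have "set as \<subseteq> S \<Longrightarrow> list_prod as \<in> U (c * length as)" for as
  proof (induction as)
    case (Cons a as)
    then have "a \<otimes> list_prod as \<in> U (c + c * length as)" using assms(1,3) by auto
    then show ?case by (simp add: list_prod_def)
  qed (simp add: list_prod_def assms(2))
  ultimately show "x \<in> U (c * n)" by blast
qed

text \<open>The union of the powers is a subalgebra containing the generating set; it is closed under sums because
  the powers increase, the unit being a generator.\<close>

lemma power_spaces_exhaust:
  assumes S: "unital_generating_set K A S"
  shows "(\<Union>n. power_space K A (span S) n) = carrier A"
proof -
  from S have SA: "S \<subseteq> carrier A" "\<one> \<in> S" unfolding unital_generating_set_def generates_algebra_def by auto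
  define V where "V = span S"
  have V: "V \<subseteq> carrier A" "\<one> \<in> V" "S \<subseteq> V"
    using span_is_subset2[OF SA(1)] in_own_span[OF SA(1)] SA(2) unfolding V_def by auto
  define P where "P = power_space K A V"
  have sm: "submodule K (P n) A" for n using power_space_subspace[OF V(1)] unfolding P_def by simp
  have mono: "m \<le> n \<Longrightarrow> P m \<subseteq> P n" for m n using power_space_mono[OF V(1,2)] unfolding P_def .
  have subP: "P n \<subseteq> carrier A" for n using sm by (rule submodule.subset)
  define B where "B = (\<Union>n. P n)"
  have add: "x \<oplus> y \<in> B" if xy: "x \<in> B" "y \<in> B" for x y
  proof -
    obtain m n where mn: "x \<in> P m" "y \<in> P n" using xy unfolding B_def by blast
    have "P m \<subseteq> P (max m n)" "P n \<subseteq> P (max m n)" by (auto intro!: mono)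
    then have "x \<oplus> y \<in> P (max m n)" using mn submodule.m_closed[OF sm] by blast
    then show ?thesis unfolding B_def by blast
  qed
  have smult: "c \<odot> x \<in> B" if "c \<in> carrier K" "x \<in> B" for c x
    using that submodule.smult_closed[OF sm] unfolding B_def by blast
  have mult: "x \<otimes> y \<in> B" if xy: "x \<in> B" "y \<in> B" for x y
    using xy power_space_mult[OF V(1)] unfolding B_def P_def by blast
  have BA: "B \<subseteq> carrier A" using subP unfolding B_def by blast
  have VB: "V \<subseteq> B" using subset_power_space[OF V(1)] unfolding B_def P_def by blast
  have "submodule K B A"
    by (rule submodule.intro[OF module_axioms])
      (use BA add smult submodule.zero_closed[OF sm] in \<open>auto simp: B_def\<close>)
  then have 1: "subspace K B A" unfolding subspace_def using vectorspace_axioms by blast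
  have 2: "subring B A"
  proof (rule A.subringI)
    fix h assume h: "h \<in> B"
    then have "(\<ominus>\<^bsub>K\<^esub> \<one>\<^bsub>K\<^esub>) \<odot> h \<in> B" by (intro smult) auto
    then show "\<ominus> h \<in> B" using h BA smult_minus_1 by auto
  qed (use BA V VB add mult in auto)
  from 1 2 S V(3) VB have "B = carrier A"
    unfolding unital_generating_set_def generates_algebra_def by blast
  then show ?thesis unfolding B_def P_def V_def .
qed

end

section \<open>Dimension of the space of matrices of a given range\<close>

context word_matrices
begin

sublocale Alg: unital_algebra K alg
  by (rule unital_algebra_alg)

text \<open>The index \<open>i - N\<close> centres the word at \<open>i\<close>, so that cylinders have range \<open>N\<close>.\<close>

definition cylinder :: "nat \<Rightarrow> bool list \<Rightarrow> int \<Rightarrow> int \<Rightarrow> int \<Rightarrow> 'k" where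
  "cylinder N u d = shift_matrix (\<lambda>i. word_at w (i - int N) (2 * N + 1) = u) d"

definition cylinders :: "nat \<Rightarrow> (int \<Rightarrow> int \<Rightarrow> 'k) set" where
  "cylinders N = {cylinder N (word_at w x (2 * N + 1)) d | x d. \<bar>d\<bar> \<le> int N}"

lemma agree_iff_word:
  "agree N i j \<longleftrightarrow> word_at w (i - int N) (2 * N + 1) = word_at w (j - int N) (2 * N + 1)"
proof
  assume a: "agree N i j"
  show "word_at w (i - int N) (2 * N + 1) = word_at w (j - int N) (2 * N + 1)"
    unfolding word_at_eq_iff
  proof (intro allI impI)
    fix k assume "k < 2 * N + 1"
    then have "\<bar>int k - int N\<bar> \<le> int N" by linarith
    with a have "w (i + (int k - int N)) = w (j + (int k - int N))" unfolding agree_def by blast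
    then show "w (i - int N + int k) = w (j - int N + int k)" by (simp add: algebra_simps)
  qed
next
  assume e: "word_at w (i - int N) (2 * N + 1) = word_at w (j - int N) (2 * N + 1)"
  show "agree N i j" unfolding agree_def
  proof (intro allI impI)
    fix t assume t: "\<bar>t\<bar> \<le> int N"
    define k where "k = nat (t + int N)"
    have k: "int k = t + int N" "k < 2 * N + 1" using t by (auto simp: k_def)
    with e have "w (i - int N + int k) = w (j - int N + int k)" unfolding word_at_eq_iff by blast
    then show "w (i + t) = w (j + t)" by (simp add: k(1) algebra_simps)
  qed
qed

lemma cylinder_local: "\<bar>d\<bar> \<le> int N \<Longrightarrow> local_matrix N (cylinder N u d)"
  unfolding cylinder_def by (rule local_matrix_shift) (simp_all add: local_set_def agree_iff_word)

lemma cylinders_local: "v \<in> cylinders N \<Longrightarrow> local_matrix N v"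
  unfolding cylinders_def using cylinder_local by blast

lemma cylinders_closed: "cylinders N \<subseteq> carrier alg"
  using cylinders_local in_algI by blast

lemma cylinders_image:
  "cylinders N = (\<lambda>(u, d). cylinder N u d) ` (range (\<lambda>x. word_at w x (2 * N + 1)) \<times> {- int N..int N})"
  unfolding cylinders_def by (auto simp: abs_le_iff; force)

lemma cylinder_entry:
  "cylinder N u d i j = (if j = i + d \<and> word_at w (i - int N) (2 * N + 1) = u then \<one> else \<zero>)"
  by (simp add: cylinder_def shift_matrix_def)

lemma finite_cylinders: "finite (cylinders N)"
  unfolding cylinders_image using finite_words by blast

lemma card_cylinders: "card (cylinders N) = (2 * N + 1) * complexity w (2 * N + 1)"
proof -
  have "inj_on (\<lambda>(u, d). cylinder N u d) (range (\<lambda>x. word_at w x (2 * N + 1)) \<times> {- int N..int N})"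
  proof (rule inj_onI, clarify)
    fix x y d e assume eq: "cylinder N (word_at w x (2 * N + 1)) d = cylinder N (word_at w y (2 * N + 1)) e"
    have "cylinder N (word_at w x (2 * N + 1)) d (x + int N) (x + int N + d) = \<one>"
      by (simp add: cylinder_entry)
    then have "cylinder N (word_at w y (2 * N + 1)) e (x + int N) (x + int N + d) = \<one>"
      unfolding eq .
    then have "x + int N + d = x + int N + e \<and> word_at w (x + int N - int N) (2 * N + 1) = word_at w y (2 * N + 1)"
      unfolding cylinder_entry by (metis zero_not_one)
    then show "word_at w x (2 * N + 1) = word_at w y (2 * N + 1) \<and> d = e" by simp
  qed
  moreover have "card {- int N..int N} = 2 * N + 1" by (simp add: nat_eq_iff)
  ultimately show ?thesis
    unfolding cylinders_image complexity_def
    by (simp only: card_image card_cartesian_product mult.commute)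
qed

lemma finsum_entry:
  assumes "finite S" "\<And>s. s \<in> S \<Longrightarrow> f s \<in> carrier alg"
  shows "finsum alg f S i j = (\<Oplus>s\<in>S. f s i j)"
  using assms
proof (induction S rule: finite_induct)
  case empty
  then show ?case by (simp add: zero_entry)
next
  case (insert s S)
  then have "f \<in> insert s S \<rightarrow> carrier alg" by blast
  then have "finsum alg f (insert s S) = f s \<oplus>\<^bsub>alg\<^esub> finsum alg f S"
    using insert.hyps by (intro Alg.M.finsum_insert) auto
  moreover have "(\<Oplus>t\<in>insert s S. f t i j) = f s i j \<oplus> (\<Oplus>t\<in>S. f t i j)"
    using insert alg_closed by (intro finsum_insert) auto
  ultimately show ?case using insert by (simp add: add_entry)
qed

text \<open>A matrix of range \<open>N\<close> is constant on the support of each cylinder; its value there is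
  read off at a chosen occurrence of the word.\<close>

lemma cylinders_span:
  assumes a: "local_matrix N a"
  shows "a \<in> Alg.span (cylinders N)"
proof -
  define rep where "rep = (\<lambda>u. SOME i. word_at w (i - int N) (2 * N + 1) = u)"
  have rep: "word_at w (rep (word_at w x (2 * N + 1)) - int N) (2 * N + 1) = word_at w x (2 * N + 1)" for x
    unfolding rep_def by (rule someI[of _ "x + int N"]) simp
  define S where "S = range (\<lambda>x. word_at w x (2 * N + 1)) \<times> {- int N..int N}"
  define f where "f = (\<lambda>(u, d). a (rep u) (rep u + d) \<odot>\<^bsub>alg\<^esub> cylinder N u d)"
  have finS: "finite S" unfolding S_def using finite_words by blast
  have sub: "submodule K (Alg.span (cylinders N)) alg"
    by (rule Alg.span_is_submodule[OF cylinders_closed])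
  have ac: "a i j \<in> carrier K" for i j by (rule local_matrix_closed[OF a])
  have fspan: "f p \<in> Alg.span (cylinders N)" if p: "p \<in> S" for p
  proof -
    obtain u d where ud: "p = (u, d)" by (cases p)
    have "(\<lambda>(u, d). cylinder N u d) p \<in> cylinders N" unfolding cylinders_image using p S_def by blast
    then have "cylinder N u d \<in> Alg.span (cylinders N)"
      using ud Alg.in_own_span[OF cylinders_closed] by auto
    then show ?thesis using submodule.smult_closed[OF sub ac] by (simp add: f_def ud)
  qed
  have fc: "f p \<in> carrier alg" if "p \<in> S" for p
    using fspan[OF that] submodule.subset[OF sub] by blast
  have "finsum alg f S = a"
  proof (intro ext)
    fix i j
    have e: "finsum alg f S i j = (\<Oplus>p\<in>S. f p i j)" by (rule finsum_entry[OF finS fc])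
    define u where "u = word_at w (i - int N) (2 * N + 1)"
    have fe: "f (v, d) i j = (if j = i + d \<and> u = v then a (rep v) (rep v + d) else \<zero>)" for v d
      using ac by (simp add: f_def smult_entry cylinder_entry u_def)
    have fz: "f p i j = \<zero>" if "p \<noteq> (u, j - i)" for p
    proof (cases p)
      case (Pair v d)
      then have "\<not> (j = i + d \<and> u = v)" using that by auto
      then show ?thesis unfolding Pair fe by (rule if_not_P)
    qed
    show "finsum alg f S i j = a i j"
    proof (cases "\<bar>i - j\<bar> \<le> int N")
      case True
      then have "(u, j - i) \<in> S" by (auto simp: S_def u_def)
      then have "finsum alg f S i j = f (u, j - i) i j" unfolding e
        using finS fc alg_closed fz by (intro finsum_eq_single) auto
      also have "\<dots> = a (rep u) (rep u + (j - i))" by (simp add: fe)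
      also have "\<dots> = a i (i + (j - i))"
        unfolding u_def by (rule local_matrix_agree[OF a]) (simp only: agree_iff_word rep)
      finally show ?thesis by simp
    next
      case False
      then have "f p i j = \<zero>" if "p \<in> S" for p
        using that fe by (cases p) (auto simp: S_def)
      then have "(\<Oplus>p\<in>S. f p i j) = \<zero>" by (intro add.finprod_one_eqI)
      then show ?thesis unfolding e using local_matrix_outside[OF a] False by simp
    qed
  qed
  moreover have "finsum alg f S \<in> Alg.span (cylinders N)"
    by (rule Alg.subspace_of_finsum[OF sub finS fspan])
  ultimately show ?thesis by simp
qed

text \<open>Distinct cylinders have disjoint supports.\<close>

lemma cylinders_lin_indpt: "Alg.lin_indpt (cylinders N)"
proof (rule Alg.finite_lin_indpt2[OF finite_cylinders cylinders_closed], rule ballI)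
  fix a v
  assume a: "a \<in> cylinders N \<rightarrow> carrier K" and z: "Alg.lincomb a (cylinders N) = \<zero>\<^bsub>alg\<^esub>"
    and v: "v \<in> cylinders N"
  from v obtain x d where vd: "v = cylinder N (word_at w x (2 * N + 1)) d" "\<bar>d\<bar> \<le> int N"
    unfolding cylinders_def by blast
  define i where "i = x + int N"
  have c: "a t \<odot>\<^bsub>alg\<^esub> t \<in> carrier alg" if "t \<in> cylinders N" for t
    using that a cylinders_closed by (intro alg_smult_closed) auto
  have single: "(a t \<odot>\<^bsub>alg\<^esub> t) i (i + d) = \<zero>" if t: "t \<in> cylinders N" "t \<noteq> v" for t
  proof -
    from t(1) obtain y e where te: "t = cylinder N (word_at w y (2 * N + 1)) e"
      unfolding cylinders_def by blast
    have "\<not> (i + d = i + e \<and> word_at w (i - int N) (2 * N + 1) = word_at w y (2 * N + 1))"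
      using t(2) te vd(1) by (auto simp: i_def)
    then have "t i (i + d) = \<zero>" unfolding te cylinder_entry by (rule if_not_P)
    moreover have "a t \<in> carrier K" using a t(1) by blast
    ultimately show ?thesis by (simp add: smult_entry)
  qed
  have "\<zero> = Alg.lincomb a (cylinders N) i (i + d)" unfolding z zero_entry ..
  also have "\<dots> = (\<Oplus>t\<in>cylinders N. (a t \<odot>\<^bsub>alg\<^esub> t) i (i + d))"
    unfolding Alg.lincomb_def by (rule finsum_entry[OF finite_cylinders c])
  also have "\<dots> = (a v \<odot>\<^bsub>alg\<^esub> v) i (i + d)"
    using finite_cylinders v c alg_closed single by (intro finsum_eq_single) auto
  also have "\<dots> = a v \<otimes> \<one>" unfolding smult_entry by (simp add: vd(1) cylinder_entry i_def)
  also have "\<dots> = a v" using Pi_mem[OF a v] by (rule r_one)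
  finally show "a v = \<zero>" ..
qed

section \<open>Generators and growth\<close>

definition translation :: "int \<Rightarrow> int \<Rightarrow> int \<Rightarrow> 'k" where
  "translation d = shift_matrix (\<lambda>_. True) d"

definition letter :: "bool \<Rightarrow> int \<Rightarrow> int \<Rightarrow> 'k" where
  "letter b = shift_matrix (\<lambda>i. w i = b) 0"

definition generators :: "(int \<Rightarrow> int \<Rightarrow> 'k) set" where
  "generators = {\<one>\<^bsub>alg\<^esub>, translation 1, translation (- 1), letter True, letter False}"

lemma generators_closed: "generators \<subseteq> carrier alg"
proof -
  have "letter b \<in> carrier alg" for b unfolding letter_def
  proof (rule shift_in_alg[of 0], unfold local_set_def, intro allI impI)
    fix i j assume "agree 0 i j"
    then have "w (i + 0) = w (j + 0)" unfolding agree_def by (metis abs_0 of_nat_0_le_iff)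
    then show "(w i = b) = (w j = b)" by simp
  qed
  moreover have "translation d \<in> carrier alg" for d
    unfolding translation_def by (rule shift_in_alg) (simp add: local_set_def)
  ultimately show ?thesis
    unfolding generators_def using in_algI[OF local_matrix_one] by blast
qed

lemmas generators_mult = Alg.products_mult[OF generators_closed]
lemmas generators_single = Alg.products_single[OF generators_closed]

lemma translation_products: "translation d \<in> Alg.products generators (nat \<bar>d\<bar>)"
proof -
  have "translation (int n) \<in> Alg.products generators n \<and> translation (- int n) \<in> Alg.products generators n" for n
  proof (induction n)
    case 0
    have "\<one>\<^bsub>alg\<^esub> \<in> Alg.products generators 0"
      by (rule Alg.products_one) (simp add: generators_def)
    then show ?case by (simp add: translation_def one_eq_shift)
  next
    case (Suc n)
    have 1: "translation 1 \<in> Alg.products generators 1" "translation (- 1) \<in> Alg.products generators 1"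
      by (rule generators_single, simp add: generators_def)+
    have "translation (int n) \<otimes>\<^bsub>alg\<^esub> translation 1 \<in> Alg.products generators (n + 1)"
      "translation (- int n) \<otimes>\<^bsub>alg\<^esub> translation (- 1) \<in> Alg.products generators (n + 1)"
      using Suc 1 by (blast intro: generators_mult)+
    then show ?case by (simp add: translation_def shift_mult_shift add.commute)
  qed
  from this[of "nat \<bar>d\<bar>"] show ?thesis by (cases "d \<ge> 0") auto
qed

text \<open>The factors are arranged as in Horner's scheme, a letter test followed by a unit translation, to keep the number of
  generators linear in \<open>m\<close>. Testing each position separately, with a translation there and back, would cost a
  quadratic number.\<close>

lemma word_matrix_products:
  "shift_matrix (\<lambda>i. \<forall>t<m. w (i + int t) = v t) (int m) \<in> Alg.products generators (2 * m)"
proof (induction m)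
  case 0
  have "\<one>\<^bsub>alg\<^esub> \<in> Alg.products generators 0"
    by (rule Alg.products_one) (simp add: generators_def)
  then show ?case by (simp add: one_eq_shift)
next
  case (Suc m)
  have "letter (v m) \<in> generators" "translation 1 \<in> generators"
    by (cases "v m") (simp_all add: generators_def)
  with Suc have "shift_matrix (\<lambda>i. \<forall>t<m. w (i + int t) = v t) (int m) \<otimes>\<^bsub>alg\<^esub> letter (v m)
      \<otimes>\<^bsub>alg\<^esub> translation 1 \<in> Alg.products generators (2 * m + 1 + 1)"
    by (intro generators_mult generators_single)
  moreover have "shift_matrix (\<lambda>i. \<forall>t<m. w (i + int t) = v t) (int m) \<otimes>\<^bsub>alg\<^esub> letter (v m)
      \<otimes>\<^bsub>alg\<^esub> translation 1 = shift_matrix (\<lambda>i. \<forall>t<Suc m. w (i + int t) = v t) (int (Suc m))"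
    unfolding letter_def translation_def shift_mult_shift
    by (rule arg_cong2[of _ _ _ _ shift_matrix]) (auto simp: less_Suc_eq fun_eq_iff)
  ultimately show ?case by simp
qed

lemma cylinder_products:
  assumes "N \<ge> 1" "v \<in> cylinders N"
  shows "v \<in> Alg.products generators (10 * N)"
proof -
  from assms(2) obtain x d where v: "v = cylinder N (word_at w x (2 * N + 1)) d" "\<bar>d\<bar> \<le> int N"
    unfolding cylinders_def by blast
  define m where "m = 2 * N + 1"
  \<comment> \<open>The word test \<open>X\<close> reads to the right of its row and ends \<open>m\<close> places further; the outer translations centre it and correct the displacement to \<open>d\<close>.\<close>
  define X where "X = shift_matrix (\<lambda>i. \<forall>t<m. w (i + int t) = w (x + int t)) (int m)"
  have "X \<in> Alg.products generators (2 * m)" unfolding X_def by (rule word_matrix_products)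
  then have "translation (- int N) \<otimes>\<^bsub>alg\<^esub> X \<otimes>\<^bsub>alg\<^esub> translation (d - int (N + 1)) \<in>
      Alg.products generators (nat \<bar>- int N\<bar> + 2 * m + nat \<bar>d - int (N + 1)\<bar>)"
    by (intro generators_mult translation_products)
  moreover have "nat \<bar>- int N\<bar> + 2 * m + nat \<bar>d - int (N + 1)\<bar> \<le> 10 * N"
  proof -
    have "nat \<bar>- int N\<bar> = N" "nat \<bar>d - int (N + 1)\<bar> \<le> 2 * N + 1"
      using v(2) by (auto simp: nat_le_iff)
    moreover have "a + 2 * (2 * N + 1) + b \<le> 10 * N" if "a = N" "b \<le> 2 * N + 1" for a b :: nat
      using assms(1) that by presburger
    ultimately show ?thesis unfolding m_def by blast
  qed
  then have "Alg.products generators (nat \<bar>- int N\<bar> + 2 * m + nat \<bar>d - int (N + 1)\<bar>) \<subseteq>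
      Alg.products generators (10 * N)"
    by (intro Alg.products_mono[OF generators_closed]) (simp_all add: generators_def)
  moreover have "translation (- int N) \<otimes>\<^bsub>alg\<^esub> X \<otimes>\<^bsub>alg\<^esub> translation (d - int (N + 1)) = v"
    unfolding v(1) X_def translation_def shift_mult_shift cylinder_def word_at_eq_iff m_def[symmetric]
    by (rule arg_cong2[of _ _ _ _ shift_matrix]) (auto simp: m_def)
  ultimately show ?thesis by blast
qed

lemma generators_span:
  assumes W: "submodule K W alg" "Alg.products generators (10 * N) \<subseteq> W" and N: "N \<ge> 1" and a: "local_matrix N a"
  shows "a \<in> W"
proof -
  have "cylinders N \<subseteq> W" using cylinder_products[OF N] W(2) by blast
  then have "Alg.span (cylinders N) \<subseteq> W" using W(1) by (rule Alg.span_is_subset)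
  then show ?thesis using cylinders_span[OF a] by blast
qed

lemma unital_generators: "unital_generating_set K alg generators"
  unfolding unital_generating_set_def generates_algebra_def
proof (intro conjI allI impI)
  fix B assume B: "subring B alg \<and> subspace K B alg \<and> generators \<subseteq> B"
  have sm: "submodule K B alg" using B Alg.is_module by blast
  have BA: "B \<subseteq> carrier alg" using sm by (rule submodule.subset)
  have "a \<in> B" if a: "a \<in> carrier alg" for a
  proof -
    obtain N where N: "local_matrix N a" using a by (auto simp: in_alg)
    have "Alg.products generators (10 * max N 1) \<subseteq> B"
      using Alg.list_prod_in_filtration[of "\<lambda>_. B" generators 0] B
        subringE(3,6)[of B alg] by blast
    then show ?thesis using generators_span[OF sm, of "max N 1"] local_matrix_mono[OF N, of "max N 1"] by simp
  qed
  then show "B = carrier alg" using BA by blast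
qed (auto simp: generators_def intro: subsetD[OF generators_closed[unfolded generators_def]])

lemma submodule_local: "submodule K {a. local_matrix N a} alg"
  by (rule submodule.intro[OF Alg.module_axioms])
    (auto simp: local_matrix_add local_matrix_smult local_matrix_zero intro: in_algI)

text \<open>A finite generating set has a common range \<open>c\<close>, and ranges add under multiplication.\<close>

lemma power_space_local:
  assumes "unital_generating_set K alg S"
  shows "\<exists>c\<ge>1. \<forall>n. power_space K alg (Alg.span S) n \<subseteq> {a. local_matrix (c * n) a}"
proof -
  from assms have S: "finite S" "S \<subseteq> carrier alg"
    unfolding unital_generating_set_def generates_algebra_def by auto
  have "\<exists>c\<ge>1. \<forall>s\<in>S. local_matrix c s"
    using S
  proof (induction S rule: finite_induct)
    case (insert s S)
    then obtain c where c: "c \<ge> 1" "\<forall>s\<in>S. local_matrix c s" by auto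
    obtain d where "local_matrix d s" using insert.prems by (auto simp: in_alg)
    then have "\<forall>t\<in>insert s S. local_matrix (max c d) t"
      using c(2) local_matrix_mono by (metis insert_iff max.cobounded1 max.cobounded2)
    then show ?case using c(1) by (intro exI[of _ "max c d"]) auto
  qed auto
  then obtain c where c: "c \<ge> 1" "S \<subseteq> {a. local_matrix c a}" by blast
  have VU: "Alg.span S \<subseteq> {a. local_matrix c a}"
    using c(2) submodule_local by (rule Alg.span_is_subset)
  have "Alg.products (Alg.span S) n \<subseteq> {a. local_matrix (c * n) a}" for n
    by (rule Alg.list_prod_in_filtration[of "\<lambda>n. {a. local_matrix n a}"])
      (use VU local_matrix_mult local_matrix_one in auto)
  then have "power_space K alg (Alg.span S) n \<subseteq> {a. local_matrix (c * n) a}" for n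
    unfolding Alg.power_space_eq using submodule_local by (rule Alg.span_is_subset)
  then show ?thesis using c(1) by blast
qed

lemma span_generating_set_closed:
  "unital_generating_set K alg S \<Longrightarrow> Alg.span S \<subseteq> carrier alg"
  unfolding unital_generating_set_def generates_algebra_def using Alg.span_is_subset2 by blast

theorem growth_upper:
  assumes S: "unital_generating_set K alg S"
  shows "\<exists>c\<ge>1. \<forall>n. growth K alg S n \<le> (2 * (c * n) + 1) * complexity w (2 * (c * n) + 1)"
proof -
  obtain c where c: "c \<ge> 1"
    "\<And>n. power_space K alg (Alg.span S) n \<subseteq> {a. local_matrix (c * n) a}"
    using power_space_local[OF S] by blast
  have "growth K alg S n \<le> card (cylinders (c * n))" for n
    unfolding growth_def
  proof (rule Alg.finite_basis_in_spanned(2))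
    show "subspace K (power_space K alg (Alg.span S) n) alg"
      by (rule Alg.power_space_subspace[OF span_generating_set_closed[OF S]])
    show "power_space K alg (Alg.span S) n \<subseteq> Alg.span (cylinders (c * n))"
      using c(2) cylinders_span by blast
  qed (rule finite_cylinders cylinders_closed)+
  then show ?thesis using c(1) unfolding card_cylinders by blast
qed

text \<open>The five generators lie in some power of the given generating space, and every cylinder is a short
  product of them.\<close>

theorem growth_lower:
  assumes S: "unital_generating_set K alg S"
  shows "\<exists>c\<ge>1. \<forall>n\<ge>1. (2 * n + 1) * complexity w (2 * n + 1) \<le> growth K alg S (c * n)"
proof -
  define P where "P = power_space K alg (Alg.span S)"
  note VA = span_generating_set_closed[OF S]
  have SA: "S \<subseteq> carrier alg" "\<one>\<^bsub>alg\<^esub> \<in> S"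
    using S unfolding unital_generating_set_def generates_algebra_def by auto
  have V1: "\<one>\<^bsub>alg\<^esub> \<in> Alg.span S" using SA Alg.in_own_span by blast
  have mono: "P m \<subseteq> P n" if "m \<le> n" for m n
    unfolding P_def by (rule Alg.power_space_mono[OF VA V1 that])
  have "\<exists>m. T \<subseteq> P m" if "finite T" "T \<subseteq> carrier alg" for T
    using that
  proof (induction T rule: finite_induct)
    case (insert t T)
    then obtain m where m: "T \<subseteq> P m" by auto
    have "t \<in> (\<Union>n. P n)" using insert.prems Alg.power_spaces_exhaust[OF S] unfolding P_def by blast
    then obtain n where n: "t \<in> P n" by blast
    have "insert t T \<subseteq> P (max m n)" using m n mono[of m "max m n"] mono[of n "max m n"] by auto
    then show ?case by blast
  qed auto
  from this[OF _ generators_closed] obtain m0 where m0: "generators \<subseteq> P m0"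
    by (auto simp: generators_def)
  define m where "m = max m0 1"
  have m: "generators \<subseteq> P m" "m \<ge> 1" using m0 mono[of m0 m] unfolding m_def by auto
  have one0: "\<one>\<^bsub>alg\<^esub> \<in> P 0"
    using Alg.products_one[OF V1] Alg.in_own_span[OF Alg.products_closed[OF VA]]
    unfolding P_def Alg.power_space_eq by blast
  have prods: "Alg.products generators n \<subseteq> P (m * n)" for n
  proof (rule Alg.list_prod_in_filtration[of P, OF _ one0 m(1)])
    show "x \<otimes>\<^bsub>alg\<^esub> y \<in> P (i + j)" if "x \<in> P i" "y \<in> P j" for x y i j
      using that unfolding P_def by (rule Alg.power_space_mult[OF VA])
  qed
  obtain c where c: "\<And>n. P n \<subseteq> {a. local_matrix (c * n) a}"
    using power_space_local[OF S] unfolding P_def by blast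
  have "card (cylinders n) \<le> growth K alg S (10 * m * n)" if n: "n \<ge> 1" for n
    unfolding growth_def P_def[symmetric]
  proof (rule Alg.card_le_dim_subspace)
    show "subspace K (P (10 * m * n)) alg"
      unfolding P_def by (rule Alg.power_space_subspace[OF VA])
    show "P (10 * m * n) \<subseteq> Alg.span (cylinders (c * (10 * m * n)))"
      using c cylinders_span by blast
    show "cylinders n \<subseteq> P (10 * m * n)"
      using cylinder_products[OF n] prods[of "10 * n"] by (auto simp: ac_simps)
  qed (rule finite_cylinders cylinders_closed cylinders_lin_indpt)+
  then show ?thesis using m(2) unfolding card_cylinders by (intro exI[of _ "10 * m"]) auto
qed

end

section \<open>The complexity of the Toeplitz sequence\<close>

lemma period_bounds: "2 ^ (k + 2) \<le> period k" "period k \<le> 2 ^ (2 * k + 4)"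
proof -
  have "(1::nat) * 2 ^ Suc k \<le> Suc k * 2 ^ Suc k" by (intro mult_right_mono) auto
  then show "2 ^ (k + 2) \<le> period k" unfolding period_def pattern_length_def by simp
  have "Suc k * 2 ^ Suc k \<le> 2 ^ Suc k * 2 ^ Suc k"
    using less_exp[of "Suc k"] by (intro mult_right_mono) auto
  also have "\<dots> = (2 ^ (2 * k + 2) :: nat)"
    unfolding power_add[symmetric] by (rule arg_cong[of _ _ "(^) 2"]) simp
  finally have "pattern_length k \<le> 2 ^ (2 * k + 2)" unfolding pattern_length_def .
  moreover have "(1::nat) \<le> 2 ^ (2 * k + 2)" by simp
  moreover have "(2::nat) ^ (2 * k + 4) = 4 * 2 ^ (2 * k + 2)" by (simp add: power_add)
  ultimately show "period k \<le> 2 ^ (2 * k + 4)" unfolding period_def by linarith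
qed

text \<open>The periods grow at least geometrically, so their product is at least \<open>2 ^ (k * k / 2)\<close>; squaring
  removes the fraction.\<close>

lemma level_length_square: "2 ^ (k * k) \<le> (level_length k)\<^sup>2"
proof (induction k)
  case (Suc k)
  have "2 ^ (Suc k * Suc k) \<le> (2::nat) ^ (k * k) * (2 ^ (k + 2))\<^sup>2"
    unfolding power_mult[symmetric] power_add[symmetric] by (intro power_increasing) auto
  also have "\<dots> \<le> (level_length k)\<^sup>2 * (period k)\<^sup>2"
    by (intro mult_mono Suc power_mono period_bounds(1)) auto
  finally show ?case by (simp add: power_mult_distrib)
qed simp

lemma level_length_pos: "level_length k \<ge> 1"
  by (induction k) (use period_ge in \<open>auto simp: Suc_le_eq intro: less_le_trans[of 0 6]\<close>)

lemma level_length_less: "level_length k < level_length (Suc k)"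
  using level_length_pos[of k] period_ge[of k] by simp

lemma level_length_ge: "k < level_length k"
proof (induction k)
  case (Suc k)
  then show ?case using level_length_less[of k] by linarith
qed simp

lemma level_between:
  assumes "m \<ge> 1" shows "\<exists>k. level_length k \<le> m \<and> m < level_length (Suc k)"
proof -
  define k where "k = (LEAST k. m < level_length k)"
  have k: "m < level_length k" unfolding k_def by (rule LeastI[of _ m]) (rule level_length_ge)
  then have "k \<noteq> 0" using assms by (intro notI) simp
  then obtain j where j: "k = Suc j" using not0_implies_Suc by blast
  have "\<not> m < level_length j" using not_less_Least[of j "\<lambda>k. m < level_length k"] j k_def by simp
  with k j show ?thesis by (intro exI[of _ j]) (simp del: level_length_Suc)
qed

text \<open>Compare with the full length of the next level, where only one letter of that level is left
  undetermined.\<close>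

lemma complexity_upper:
  assumes "m \<ge> 1" "level_length k \<le> m" "m < level_length (Suc k)"
  shows "complexity (toeplitz 0) m \<le> 2 * period k * m"
proof -
  have "complexity (toeplitz 0) m \<le> complexity (toeplitz 0) (1 * level_length (Suc k))"
    using assms(3) by (intro complexity_mono) simp
  also have "\<dots> = level_length (Suc k) * complexity (toeplitz (Suc k)) 1"
    by (rule complexity_level) simp
  also have "\<dots> \<le> (m * period k) * 2"
    unfolding level_length_Suc by (intro mult_mono complexity_1 assms) auto
  finally show ?thesis by (simp add: ac_simps)
qed

text \<open>Here \<open>ln (period k)\<close> is linear in \<open>k\<close>, while \<open>k * k * ln 2 \<le> 2 * ln m\<close> by \<open>level_length_square\<close>; so the
  excess over \<open>ln m\<close> is of the order of the square root of \<open>ln m\<close>.\<close>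

lemma ln_complexity_upper:
  assumes m: "m \<ge> 1"
  shows "ln (real (complexity (toeplitz 0) m)) \<le> ln (real m) + 2 * sqrt (4 * ln (real m)) + 5"
proof -
  obtain k where k: "level_length k \<le> m" "m < level_length (Suc k)" using level_between[OF m] by blast
  have ln2: "0 < ln (2::real)" "ln (2::real) \<le> 1" "1 / 2 \<le> ln (2::real)"
    using ln_le_minus_one[of "2::real"] ln_le_minus_one[of "1 / 2 :: real"] by (auto simp: ln_div)
  have "complexity (toeplitz 0) m \<le> 2 * period k * m" by (rule complexity_upper[OF m k])
  also have "\<dots> \<le> 2 * 2 ^ (2 * k + 4) * m" using period_bounds(2)[of k] by simp
  finally have "real (complexity (toeplitz 0) m) \<le> real (2 ^ (2 * k + 5) * m)"
    unfolding of_nat_le_iff by (simp add: power_add)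
  also have "\<dots> = 2 ^ (2 * k + 5) * real m" by simp
  finally have "ln (real (complexity (toeplitz 0) m)) \<le> ln (2 ^ (2 * k + 5) * real m)"
    using complexity_pos m by (subst ln_le_cancel_iff) auto
  also have "\<dots> = real (2 * k + 5) * ln 2 + ln (real m)"
    using m by (simp add: ln_mult ln_realpow)
  finally have 1: "ln (real (complexity (toeplitz 0) m)) \<le> real (2 * k + 5) * ln 2 + ln (real m)" .
  have "2 ^ (k * k) \<le> m\<^sup>2"
    using level_length_square[of k] power_mono[OF k(1), of 2] by linarith
  then have "real (2 ^ (k * k)) \<le> real (m\<^sup>2)" unfolding of_nat_le_iff .
  then have "(2::real) ^ (k * k) \<le> (real m)\<^sup>2" by simp
  then have "ln ((2::real) ^ (k * k)) \<le> ln ((real m)\<^sup>2)" using m by (subst ln_le_cancel_iff) auto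
  then have "real (k * k) * ln 2 \<le> 2 * ln (real m)" using m by (simp add: ln_realpow)
  moreover have "real (k * k) * (1 / 2) \<le> real (k * k) * ln 2" by (intro mult_left_mono ln2) auto
  ultimately have "(real k)\<^sup>2 \<le> 4 * ln (real m)" by (simp add: power2_eq_square)
  then have "real k \<le> sqrt (4 * ln (real m))" by (rule real_le_rsqrt)
  then have "real (2 * k + 5) \<le> 2 * sqrt (4 * ln (real m)) + 5" by simp
  moreover have "real (2 * k + 5) * ln 2 \<le> real (2 * k + 5)"
    using ln2 by (intro mult_left_le) auto
  ultimately have "real (2 * k + 5) * ln 2 \<le> 2 * sqrt (4 * ln (real m)) + 5"
    by (rule order_trans[rotated])
  from add_right_mono[OF this, of "ln (real m)"] order_trans[OF 1] show ?thesis
    by (simp only: ac_simps)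
qed

lemma complexity_lower: "level_length k * 2 ^ Suc k \<le> complexity (toeplitz 0) (Suc k * level_length k)"
  using complexity_toeplitz_ge[of k] complexity_level[of "Suc k" k] by simp

lemma toeplitz_windows_separated:
  assumes "field K"
  shows "\<exists>M. \<forall>i j. word_matrices.agree (toeplitz 0) M i j \<longrightarrow> i \<noteq> j \<longrightarrow> int N < \<bar>i - j\<bar>"
proof -
  interpret word_matrices K "toeplitz 0" by (intro word_matrices.intro assms)
  define M where "M = level_length N"
  have "int N < \<bar>i - j\<bar>" if "agree M i j" "i \<noteq> j" for i j
  proof -
    have "word_at (toeplitz 0) (i - int M) (1 * M) = word_at (toeplitz 0) (j - int M) (1 * M)"
      using that(1) unfolding agree_iff_word word_at_eq_iff by simp
    from toeplitz_return_dvd[OF _ this[unfolded M_def]] obtain x y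
      where "i - j = int M * (x - y)" unfolding M_def by auto
    moreover from this have "x - y \<noteq> 0" using that(2) by auto
    then have "int M * 1 \<le> int M * \<bar>x - y\<bar>" by (intro mult_left_mono) auto
    ultimately have "int M \<le> \<bar>i - j\<bar>" by (simp add: abs_mult)
    then show ?thesis using level_length_ge[of N] unfolding M_def by linarith
  qed
  then show ?thesis by blast
qed

section \<open>The growth rate\<close>

lemma limsup_log_upper:
  assumes c: "c \<ge> (1::nat)"
    and g: "\<And>n. g n \<le> (2 * (c * n) + 1) * complexity (toeplitz 0) (2 * (c * n) + 1)"
  shows "limsup (\<lambda>n. ereal (ln (real (g n)) / ln (real n))) \<le> 2"
proof -
  define C where "C = ln (real (3 * c))"
  define h where "h = (\<lambda>n. (2 * (C + ln (real n)) + 2 * sqrt (4 * (C + ln (real n))) + 5) / ln (real n))"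
  have C: "C \<ge> 0" using c by (simp add: C_def)
  have le: "ln (real (g n)) / ln (real n) \<le> h n" if n: "n \<ge> 2" for n
  proof -
    define m where "m = 2 * (c * n) + 1"
    have m1: "m \<ge> 1" by (simp add: m_def)
    have cn: "1 \<le> c * n" using c n by simp
    then have "m \<le> 3 * c * n" unfolding m_def by simp
    then have "real m \<le> real (3 * c * n)" unfolding of_nat_le_iff .
    then have "ln (real m) \<le> ln (real (3 * c * n))" using m1 by (subst ln_le_cancel_iff) auto
    also have "\<dots> = C + ln (real n)" using c n by (simp add: C_def ln_mult)
    finally have lm: "ln (real m) \<le> C + ln (real n)" .
    have "ln (real (g n)) \<le> 2 * (C + ln (real n)) + 2 * sqrt (4 * (C + ln (real n))) + 5"
    proof (cases "g n = 0")
      case True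
      then show ?thesis using C n by simp
    next
      case False
      have "real (g n) \<le> real (m * complexity (toeplitz 0) m)"
        unfolding of_nat_le_iff using g[of n] unfolding m_def .
      then have "ln (real (g n)) \<le> ln (real (m * complexity (toeplitz 0) m))"
        using False complexity_pos m1 by (subst ln_le_cancel_iff) auto
      also have "\<dots> = ln (real m) + ln (real (complexity (toeplitz 0) m))"
        using complexity_pos[of "toeplitz 0" m] m1 by (simp add: ln_mult)
      also have "\<dots> \<le> 2 * ln (real m) + 2 * sqrt (4 * ln (real m)) + 5"
        using ln_complexity_upper[OF m1] by simp
      also have "\<dots> \<le> 2 * (C + ln (real n)) + 2 * sqrt (4 * (C + ln (real n))) + 5"
        using lm by (intro add_mono mult_left_mono real_sqrt_le_mono) auto
      finally show ?thesis .
    qed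
    then show ?thesis unfolding h_def using n by (intro divide_right_mono) auto
  qed
  have "h \<longlonglongrightarrow> 2" unfolding h_def by real_asymp
  then have "(\<lambda>n. ereal (h n)) \<longlonglongrightarrow> ereal 2" by (rule tendsto_ereal)
  then have "limsup (\<lambda>n. ereal (h n)) = 2" by (simp add: lim_imp_Limsup)
  moreover have "limsup (\<lambda>n. ereal (ln (real (g n)) / ln (real n))) \<le> limsup (\<lambda>n. ereal (h n))"
    by (rule Limsup_mono, rule eventually_sequentiallyI[of 2]) (simp add: le)
  ultimately show ?thesis by simp
qed

text \<open>Lengths at which the sequence of level \<open>k\<close> contributes all its \<open>2 ^ (k + 1)\<close> words of length
  \<open>k + 1\<close>.\<close>

definition fast_length :: "nat \<Rightarrow> nat" where
  "fast_length k = Suc k * level_length k"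

lemma fast_length_strict_mono: "strict_mono fast_length"
  unfolding strict_mono_Suc_iff fast_length_def
  by (intro allI mult_strict_mono level_length_less) auto

lemma fast_length_pos: "fast_length k \<ge> 1"
  using level_length_pos[of k] by (simp add: fast_length_def)

lemma growth_at_fast_length:
  assumes "\<And>n. n \<ge> 1 \<Longrightarrow> (2 * n + 1) * complexity (toeplitz 0) (2 * n + 1) \<le> g (c * n)"
  shows "(fast_length k)\<^sup>2 * 2 ^ Suc k \<le> g (c * fast_length k) * Suc k"
proof -
  define n where "n = fast_length k"
  have "n\<^sup>2 * 2 ^ Suc k = n * (level_length k * 2 ^ Suc k) * Suc k"
    by (simp add: n_def fast_length_def power2_eq_square ac_simps del: mult_Suc mult_Suc_right power_Suc)
  also have "\<dots> \<le> (2 * n + 1) * complexity (toeplitz 0) n * Suc k"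
    using complexity_lower[of k] unfolding n_def fast_length_def
    by (intro mult_right_mono mult_mono) auto
  also have "\<dots> \<le> (2 * n + 1) * complexity (toeplitz 0) (2 * n + 1) * Suc k"
    by (intro mult_right_mono mult_left_mono complexity_mono) auto
  also have "\<dots> \<le> g (c * n) * Suc k"
    using assms fast_length_pos unfolding n_def by (intro mult_right_mono) auto
  finally show ?thesis unfolding n_def .
qed

text \<open>It suffices to look along the subsequence \<open>c * fast_length k\<close>, where \<open>g\<close> is at least
  the square of \<open>fast_length k\<close>.\<close>

lemma limsup_log_lower:
  assumes c: "c \<ge> (1::nat)"
    and g: "\<And>n. n \<ge> 1 \<Longrightarrow> (2 * n + 1) * complexity (toeplitz 0) (2 * n + 1) \<le> g (c * n)"
  shows "2 \<le> limsup (\<lambda>n. ereal (ln (real (g n)) / ln (real n)))"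
proof -
  define f where "f = (\<lambda>n. ereal (ln (real (g n)) / ln (real n)))"
  define r where "r = (\<lambda>k. c * fast_length k)"
  define h where "h = (\<lambda>n. 2 * ln (real n) / (ln (real c) + ln (real n)))"
  have r: "strict_mono r" using fast_length_strict_mono c unfolding strict_mono_def r_def by simp
  have le: "ereal (h (fast_length k)) \<le> (f \<circ> r) k" for k
  proof -
    define n where "n = fast_length k"
    have n: "n \<ge> 1" unfolding n_def by (rule fast_length_pos)
    have "n\<^sup>2 * Suc k \<le> n\<^sup>2 * 2 ^ Suc k" using less_exp[of "Suc k"] by (intro mult_left_mono) auto
    also have "\<dots> \<le> g (r k) * Suc k" using growth_at_fast_length[OF g] unfolding n_def r_def .
    finally have "n\<^sup>2 \<le> g (r k)" by (simp del: mult_Suc_right)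
    then have "real (n\<^sup>2) \<le> real (g (r k))" unfolding of_nat_le_iff .
    moreover have "0 < real (n\<^sup>2)" using n by simp
    ultimately have "ln (real (n\<^sup>2)) \<le> ln (real (g (r k)))" by (subst ln_le_cancel_iff) linarith+
    then have "2 * ln (real n) \<le> ln (real (g (r k)))" using n by (simp add: ln_realpow)
    moreover have "ln (real (r k)) = ln (real c) + ln (real n)"
      using c n by (simp add: r_def n_def[symmetric] ln_mult)
    moreover have "0 \<le> ln (real c) + ln (real n)" using c n by simp
    ultimately have "h n \<le> ln (real (g (r k))) / ln (real (r k))"
      unfolding h_def by (simp add: divide_right_mono)
    then show ?thesis unfolding f_def n_def by simp
  qed
  have "h \<longlonglongrightarrow> 2" unfolding h_def by real_asymp
  then have "(\<lambda>k. h (fast_length k)) \<longlonglongrightarrow> 2"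
    by (rule filterlim_compose) (rule filterlim_subseq[OF fast_length_strict_mono])
  then have "(\<lambda>k. ereal (h (fast_length k))) \<longlonglongrightarrow> ereal 2" by (rule tendsto_ereal)
  from lim_imp_Limsup[OF _ this] have "2 = limsup (\<lambda>k. ereal (h (fast_length k)))" by simp
  also have "\<dots> \<le> limsup (f \<circ> r)" by (rule Limsup_mono) (simp add: le del: o_apply)
  also have "\<dots> \<le> limsup f" by (rule limsup_subseq_mono[OF r])
  finally show ?thesis unfolding f_def .
qed

text \<open>Along \<open>c * fast_length k\<close> the quotient of \<open>g n\<close> by \<open>n\<^sup>2\<close> is at least a constant times
  \<open>2 ^ (k + 1) / (k + 1)\<close>.\<close>

lemma not_quadratically_bounded:
  assumes g: "\<And>n. n \<ge> 1 \<Longrightarrow> (2 * n + 1) * complexity (toeplitz 0) (2 * n + 1) \<le> g (c * n)"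
    and c: "c \<ge> (1::nat)"
  shows "\<exists>n\<ge>1. C * (real n)\<^sup>2 < real (g n)"
proof (rule ccontr)
  assume "\<not> ?thesis"
  then have le: "real (g n) \<le> C * (real n)\<^sup>2" if "n \<ge> 1" for n using that by (meson not_less)
  define D where "D = C * (real c)\<^sup>2"
  have "2 ^ Suc k \<le> D * real (Suc k)" for k
  proof -
    define n where "n = fast_length k"
    have n: "n \<ge> 1" unfolding n_def by (rule fast_length_pos)
    have "n\<^sup>2 * 2 ^ Suc k \<le> g (c * n) * Suc k"
      using growth_at_fast_length[OF g] unfolding n_def .
    then have "real (n\<^sup>2 * 2 ^ Suc k) \<le> real (g (c * n) * Suc k)" unfolding of_nat_le_iff .
    then have "(real n)\<^sup>2 * 2 ^ Suc k \<le> real (g (c * n)) * real (Suc k)"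
      by (simp only: of_nat_mult of_nat_power of_nat_numeral)
    also have "\<dots> \<le> (C * (real (c * n))\<^sup>2) * real (Suc k)"
      using c n by (intro mult_right_mono le) auto
    also have "\<dots> = (real n)\<^sup>2 * (D * real (Suc k))"
      by (simp add: D_def power_mult_distrib)
    finally show ?thesis using n by (subst (asm) mult_le_cancel_left_pos) auto
  qed
  moreover have "eventually (\<lambda>k. D * real (Suc k) < 2 ^ Suc k) sequentially" by real_asymp
  ultimately show False unfolding eventually_sequentially by (meson not_less order_refl)
qed

theorem mainTheorem4:
  fixes K :: "('k, 'l) ring_scheme"
  assumes "field K"
  shows "\<exists>A :: 'k fg_algebra_record.
    unital_algebra K A \<and> simple_algebra A \<and> finitely_generated_algebra K A \<and>
    has_GK_dimension K A 2 \<and> \<not> quadratic_growth K A"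
proof -
  interpret word_matrices K "toeplitz 0" by (intro word_matrices.intro assms)
  have fg: "finitely_generated_algebra K alg"
    using unital_generators unfolding finitely_generated_algebra_def unital_generating_set_def by blast
  have simple: "simple_algebra alg"
    by (rule simple_alg[OF toeplitz_returns toeplitz_windows_separated[OF assms]])
  have dim: "has_GK_dimension K alg 2"
    unfolding has_GK_dimension_def
  proof (intro conjI allI impI fg antisym)
    fix S assume S: "unital_generating_set K alg S"
    show "limsup (\<lambda>n. ereal (ln (real (growth K alg S n)) / ln (real n))) \<le> 2"
      using growth_upper[OF S] limsup_log_upper by metis
    show "2 \<le> limsup (\<lambda>n. ereal (ln (real (growth K alg S n)) / ln (real n)))"
      using growth_lower[OF S] limsup_log_lower by metis
  qed
  have "\<not> quadratic_growth K alg"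
  proof
    assume "quadratic_growth K alg"
    then obtain S C where S: "unital_generating_set K alg S"
      and C: "\<And>n. n \<ge> 1 \<Longrightarrow> real (growth K alg S n) \<le> C * (real n)\<^sup>2"
      unfolding quadratic_growth_def by blast
    obtain c where c: "c \<ge> 1"
      "\<And>n. n \<ge> 1 \<Longrightarrow> (2 * n + 1) * complexity (toeplitz 0) (2 * n + 1) \<le> growth K alg S (c * n)"
      using growth_lower[OF S] by blast
    from not_quadratically_bounded[OF c(2,1), of C] C show False by (meson not_less)
  qed
  with unital_algebra_alg simple fg dim show ?thesis by blast
qed

end
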